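(* For every $\xi\in\mathcal{D}^o$, every $N,M,K\in\mathbb{N}$, every bounded $f:\Omega\times U^{\mathbb{N}}\to\mathbb{R}$ such that $f(\cdot,(z_i)_{i\ge1})$ does not depend on $(z_i)_{i>K}$ and is $\mathcal{B}_{-N}^+\cap\mathcal{B}_M^-$-measurable for each $(z_i)_{i\ge1}$, and every $\epsilon>0$, $$\limsup_{\delta\to0}\limsup_{n\to\infty}\frac1n\log P_{0,0}\left(\left|\int f\,\mathrm{d}\bar\nu_{n,X}^\infty-\int f\,\mathrm{d}\bar\mu_\xi^\infty\right|>\epsilon\ \middle|\ \left|\tfrac{X_n}{n}-\xi\right|\le\delta\right)<0.$$
   Context: Space-time RWRE on $\mathbb{Z}^d$: environment $\omega=(\omega_{n,x})_{n\in\mathbb{Z},x\in\mathbb{Z}^d}$, $\omega_{n,x}=(\pi_{n,n+1}(x,x+z))_{z\in U}$ probability vectors, $U:=\{z:|z_1|+\cdots+|z_d|=1\}$; the $\omega_{n,x}$ are i.i.d. under $\mathbb{P}$ and $\mathbb{P}(\pi_{0,1}(0,z)\ge c_1)=1$ for all $z\in U$, some $c_1>0$. $P_{k,x}^\omega$ is the quenched law of the walk with $X_k=x$ and $P(X_{n+1}=y+z\mid X_n=y)=\pi_{n,n+1}(y,y+z)$; $P_{k,x}:=\int P_{k,x}^\omega\,\mathrm{d}\mathbb{P}$, expectation $E_{k,x}$. $Z_i:=X_i-X_{i-1}$. Shifts $(T_{m,y}\omega)_{n,x}=\omega_{n+m,x+y}$. $\mathcal{B}_n^-$ (resp. $\mathcal{B}_n^+$)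 is the $\sigma$-algebra generated by $\omega_{m,x}$, $x\in\mathbb{Z}^d$, $m\le n$ (resp. $m\ge n$). $q(z):=\mathbb{E}[\pi_{0,1}(0,z)]$, $\Lambda_c(\theta):=\log\sum_{z\in U}q(z)\mathrm{e}^{\langle\theta,z\rangle}$. $\mathcal{D}:=\{\xi\in\mathbb{R}^d:|\xi_1|+\cdots+|\xi_d|\le1\}$, $\mathcal{D}^o$ its interior; for $\xi\in\mathcal{D}^o$ there is a unique $\theta$ with $\xi=\nabla\Lambda_c(\theta)$. $\bar\mu_\xi^\infty$ is the measure on $\Omega\times U^{\mathbb{N}}$ defined, for $N,M,K$ and $f$ as in the claim, by $\int f\,\mathrm{d}\bar\mu_\xi^\infty:=E_{0,0}[\mathrm{e}^{\langle\theta,X_{N+M+K+1}\rangle-(N+M+K+1)\Lambda_c(\theta)}f(T_{N,X_N}\omega,(Z_{N+i})_{i\ge1})]$. The empirical process is $\bar\nu_{n,X}^\infty:=\frac1n\sum_{j=0}^{n-1}\delta_{(T_{j,X_j}\omega,(Z_{j+i})_{i\ge1})}$. *)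

theory Defs
  imports "HOL-Probability.Probability"
begin

definition U :: "(int^'d::finite) set" where
  "U = {z. (\<Sum>i\<in>UNIV. \<bar>z$i\<bar>) = 1}"

definition PV :: "(int^'d::finite \<Rightarrow> real) set" where
  "PV = {v. (\<forall>z. 0 \<le> v z) \<and> (\<forall>z. z \<notin> U \<longrightarrow> v z = 0) \<and> (\<Sum>z\<in>U. v z) = 1}"

text \<open>An environment: omega (n,x) z = pi_{n,n+1}(x,x+z).\<close>
type_synonym 'd env = "int \<times> (int^'d) \<Rightarrow> (int^'d) \<Rightarrow> real"

definition Omega :: "('d::finite) env set" where
  "Omega = {\<omega>. \<forall>n x. \<omega> (n,x) \<in> PV}"

definition locM :: "(int^'d::finite \<Rightarrow> real) measure" where
  "locM = PiM UNIV (\<lambda>_. borel)"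

definition env_law :: "(int^'d::finite \<Rightarrow> real) measure \<Rightarrow> ('d env) measure" where
  "env_law \<alpha> = PiM UNIV (\<lambda>_. \<alpha>)"

definition shift :: "int \<Rightarrow> int^'d::finite \<Rightarrow> 'd env \<Rightarrow> 'd env" where
  "shift m y \<omega> = (\<lambda>(n,x). \<omega> (n+m, x+y))"

fun qprob :: "('d::finite) env \<Rightarrow> int \<Rightarrow> int^'d \<Rightarrow> (int^'d) list \<Rightarrow> real" where
  "qprob \<omega> k x [] = 1"
| "qprob \<omega> k x (z#zs) = \<omega> (k,x) z * qprob \<omega> (k+1) (x+z) zs"

definition paths :: "nat \<Rightarrow> (int^'d::finite) list set" where
  "paths m = {zs. set zs \<subseteq> U \<and> length zs = m}"

definition stepseq :: "(int^'d::finite) list \<Rightarrow> nat \<Rightarrow> int^'d" where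
  "stepseq zs i = (if 1 \<le> i \<and> i \<le> length zs then zs ! (i - 1) else (SOME z. z \<in> U))"

definition Xpos :: "(nat \<Rightarrow> int^'d::finite) \<Rightarrow> nat \<Rightarrow> int^'d" where
  "Xpos Z j = (\<Sum>i\<in>{1..j}. Z i)"

text \<open>Annealed expectation E_{0,0} of a functional of (omega, (Z_i)) depending
  on the first m steps only.\<close>
definition annE :: "(int^'d::finite \<Rightarrow> real) measure \<Rightarrow> nat \<Rightarrow>
    ('d env \<Rightarrow> (nat \<Rightarrow> int^'d) \<Rightarrow> real) \<Rightarrow> real" where
  "annE \<alpha> m F = set_lebesgue_integral (env_law \<alpha>) Omega
     (\<lambda>\<omega>. \<Sum>zs\<in>paths m. qprob \<omega> 0 0 zs * F \<omega> (stepseq zs))"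

definition annP :: "(int^'d::finite \<Rightarrow> real) measure \<Rightarrow> nat \<Rightarrow>
    ('d env \<Rightarrow> (nat \<Rightarrow> int^'d) \<Rightarrow> bool) \<Rightarrow> real" where
  "annP \<alpha> m E = annE \<alpha> m (\<lambda>\<omega> Z. if E \<omega> Z then 1 else 0)"

definition Bplus :: "int \<Rightarrow> ('d::finite) env set set" where
  "Bplus n = sigma_sets Omega
     {{\<omega>\<in>Omega. \<omega> (m,x) \<in> A} | m x A. n \<le> m \<and> A \<in> sets locM}"

definition Bminus :: "int \<Rightarrow> ('d::finite) env set set" where
  "Bminus n = sigma_sets Omega
     {{\<omega>\<in>Omega. \<omega> (m,x) \<in> A} | m x A. m \<le> n \<and> A \<in> sets locM}"

definition rvec :: "int^'d::finite \<Rightarrow> real^'d" where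
  "rvec z = (\<chi> i. real_of_int (z$i))"

definition qmean :: "(int^'d::finite \<Rightarrow> real) measure \<Rightarrow> int^'d \<Rightarrow> real" where
  "qmean \<alpha> z = (\<integral>\<omega>. \<omega> (0,0) z \<partial>(env_law \<alpha>))"

definition Lambda_c :: "(int^'d::finite \<Rightarrow> real) measure \<Rightarrow> real^'d \<Rightarrow> real" where
  "Lambda_c \<alpha> \<theta> = ln (\<Sum>z\<in>U. qmean \<alpha> z * exp (\<theta> \<bullet> rvec z))"

definition theta_of :: "(int^'d::finite \<Rightarrow> real) measure \<Rightarrow> real^'d \<Rightarrow> real^'d" where
  "theta_of \<alpha> \<xi> = (THE \<theta>. (Lambda_c \<alpha> has_derivative (\<lambda>h. \<xi> \<bullet> h)) (at \<theta>))"

text \<open>integral of f against mu-bar_xi^infinity, defined with the given N M K.\<close>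
definition mu_bar :: "(int^'d::finite \<Rightarrow> real) measure \<Rightarrow> real^'d \<Rightarrow> nat \<Rightarrow> nat \<Rightarrow> nat \<Rightarrow>
    ('d env \<times> (nat \<Rightarrow> int^'d) \<Rightarrow> real) \<Rightarrow> real" where
  "mu_bar \<alpha> \<xi> N M K f =
     (let L = N + M + K + 1; \<theta> = theta_of \<alpha> \<xi> in
      annE \<alpha> L (\<lambda>\<omega> Z. exp (\<theta> \<bullet> rvec (Xpos Z L) - real L * Lambda_c \<alpha> \<theta>)
                       * f (shift (int N) (Xpos Z N) \<omega>, \<lambda>i. Z (N + i + 1))))"

text \<open>integral of f against the empirical process nu-bar_{n,X}^infinity;
  the sequence argument s encodes (z_i)_{i>=1} as s i = z_{i+1}.\<close>
definition nu_bar :: "('d::finite env \<times> (nat \<Rightarrow> int^'d) \<Rightarrow> real) \<Rightarrow> nat \<Rightarrow> 'd env \<Rightarrow>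
    (nat \<Rightarrow> int^'d) \<Rightarrow> real" where
  "nu_bar f n \<omega> Z = (1 / real n) * (\<Sum>j<n. f (shift (int j) (Xpos Z j) \<omega>, \<lambda>i. Z (j + i + 1)))"

definition eln :: "real \<Rightarrow> ereal" where
  "eln x = (if x \<le> 0 then -\<infinity> else ereal (ln x))"

end

theory Submission
  imports Defs
begin

text \<open>
  The annealed walk meets each time level once. Tilting the annealed law by
  \<open>exp (\<theta> \<bullet> X\<^sub>m - m \<Lambda>\<^sub>c \<theta>)\<close> with \<open>\<theta> = theta_of \<alpha> \<xi>\<close> therefore makes the levels of the environment
  seen from the walk, together with the steps, independent and identically distributed, with mean
  step \<open>\<xi>\<close>. The summands of the empirical average are bounded functionals of \<open>L = N + M + K + 1\<close>
  consecutive levels, so Chernoff's bound along each residue class modulo \<open>L\<close> gives exponential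
  concentration at \<open>mu_bar\<close>, and applied to the steps it gives a law of large numbers for \<open>X\<^sub>n / n\<close>.
  On the conditioning event the tilting density is constant up to a factor
  \<open>exp (\<plusminus> norm \<theta> * (K + n \<delta>))\<close>, which does not spoil the exponential decay once \<open>\<delta>\<close> is small.
\<close>

section \<open>Steps, environments and shifts\<close>

text \<open>Step \<open>n + 1\<close> is drawn from level \<open>n\<close>. Cutting a path at time
  \<open>a\<close> therefore also cuts the environment into the levels below \<open>a\<close> and
  those from \<open>a\<close> on, and both the quenched path weight and the tilting density are
  products over the cut. Averaged over the environment, one step has law \<open>qmean\<close>, which
  is why \<open>Lambda_c\<close> is the right normalisation. Three obstacles shape the details. The
  observable looks \<open>N\<close> levels back, hence below level 0 at early times; it is replaced
  by its translate by \<open>N\<close>, which changes the average only by boundary terms. The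
  windows of the last summands overrun the horizon, so these summands are discarded as well.
  Finally, \<open>f\<close> is controlled only on \<open>Omega\<close> and on
  \<open>U\<close>-valued sequences, whereas the environment law lives on all functions, so
  functionals are first made total by a retraction.\<close>

lemma finite_U: "finite (U :: (int^'d::finite) set)"
proof -
  have "U \<subseteq> vec_lambda ` (PiE (UNIV :: 'd set) (\<lambda>_. {-1..1::int}))"
  proof
    fix z :: "int^'d" assume z: "z \<in> U"
    have "z $ i \<in> {-1..1}" for i
    proof -
      have "\<bar>z $ i\<bar> \<le> (\<Sum>i\<in>UNIV. \<bar>z$i\<bar>)" by (rule member_le_sum) auto
      then show ?thesis using z unfolding U_def by auto
    qed
    then have "z = vec_lambda (vec_nth z)" "vec_nth z \<in> PiE UNIV (\<lambda>_. {-1..1})" by auto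
    then show "z \<in> vec_lambda ` (PiE (UNIV :: 'd set) (\<lambda>_. {-1..1::int}))" by blast
  qed
  then show ?thesis by (rule finite_subset) (intro finite_imageI finite_PiE, auto)
qed

lemma axis_in_U: "axis i 1 \<in> U" "axis i (-1) \<in> U" for i :: "'d::finite"
  unfolding U_def axis_def by (auto simp: if_distrib[of abs] cong: if_cong)

text \<open>The same choice term as the padding value in \<open>stepseq\<close>, so that padded step
  sequences remain \<open>U\<close>-valued.\<close>

definition u0 :: "int^'d::finite" where
  "u0 = (SOME z. z \<in> U)"

lemma u0_in_U: "u0 \<in> U"
  unfolding u0_def by (rule someI) (rule axis_in_U(1))

lemma stepseq_eq:
  "stepseq zs i = (if 1 \<le> i \<and> i \<le> length zs then zs ! (i - 1) else u0)"
  by (simp add: stepseq_def u0_def)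

lemma stepseq_in_U: "zs \<in> paths m \<Longrightarrow> stepseq zs i \<in> U"
  by (auto simp: stepseq_eq paths_def u0_in_U subset_iff)

lemma sum_paths_add:
  fixes g :: "(int^'d::finite) list \<Rightarrow> real"
  shows "(\<Sum>zs\<in>paths (a + b). g zs) = (\<Sum>zs\<in>paths a. \<Sum>zs'\<in>paths b. g (zs @ zs'))"
proof -
  have "(\<Sum>(zs, zs')\<in>paths a \<times> paths b. g (zs @ zs')) = (\<Sum>zs\<in>paths (a + b). g zs)"
  proof (rule sum.reindex_bij_witness[where i = "\<lambda>zs. (take a zs, drop a zs)"
        and j = "\<lambda>(zs, zs'). zs @ zs'"])
  qed (auto simp: paths_def dest: in_set_takeD in_set_dropD)
  then show ?thesis by (simp add: sum.cartesian_product)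
qed

lemma Xpos_stepseq: "Xpos (stepseq zs) (length zs) = sum_list zs"
proof -
  have "Xpos (stepseq zs) (length zs) = (\<Sum>i\<in>{1..length zs}. zs ! (i - 1))"
    unfolding Xpos_def by (intro sum.cong) (auto simp: stepseq_eq)
  also have "\<dots> = (\<Sum>i<length zs. zs ! i)"
    by (rule sum.reindex_bij_witness[where i = Suc and j = "\<lambda>i. i - 1"]) auto
  finally show ?thesis by (simp add: sum_list_sum_nth atLeast0LessThan)
qed

lemma Xpos_cong: "(\<And>i. i \<in> {1..a} \<Longrightarrow> Z i = Z' i) \<Longrightarrow> Xpos Z a = Xpos Z' a"
  unfolding Xpos_def by (intro sum.cong) auto

lemma Xpos_0 [simp]: "Xpos Z 0 = 0"
  by (simp add: Xpos_def)

lemma Xpos_Suc: "Xpos Z (Suc n) = Xpos Z n + Z (Suc n)"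
  by (simp add: Xpos_def)

lemma Xpos_add: "Xpos Z (a + b) = Xpos Z a + Xpos (\<lambda>i. Z (a + i)) b"
  by (induction b) (auto simp: Xpos_Suc algebra_simps)

lemma shift_shift: "shift m y (shift k x \<omega>) = shift (k + m) (x + y) \<omega>"
  by (auto simp: shift_def fun_eq_iff add_ac)

lemma shift_0 [simp]: "shift 0 0 \<omega> = \<omega>"
  by (auto simp: shift_def fun_eq_iff)

lemma qprob_append:
  "qprob \<omega> k x (zs @ zs') = qprob \<omega> k x zs * qprob \<omega> (k + int (length zs)) (x + sum_list zs) zs'"
  by (induction zs arbitrary: k x) (auto simp: algebra_simps)

lemma qprob_shift: "qprob (shift m y \<omega>) k x zs = qprob \<omega> (k + m) (x + y) zs"
  by (induction zs arbitrary: k x) (auto simp: shift_def algebra_simps)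

lemma qprob_cong:
  "(\<And>n x. n \<in> {k..<k + int (length zs)} \<Longrightarrow> \<omega> (n, x) = \<omega>' (n, x)) \<Longrightarrow>
    qprob \<omega> k x zs = qprob \<omega>' k x zs"
proof (induction zs arbitrary: k x)
  case (Cons z zs)
  have "qprob \<omega> (k + 1) (x + z) zs = qprob \<omega>' (k + 1) (x + z) zs"
    by (rule Cons.IH) (rule Cons.prems, auto)
  moreover have "\<omega> (k, x) = \<omega>' (k, x)" by (rule Cons.prems) auto
  ultimately show ?case by simp
qed simp

lemma PV_le_1: "v \<in> PV \<Longrightarrow> v z \<le> 1"
proof (cases "z \<in> U")
  case True
  assume v: "v \<in> PV"
  have "v z \<le> (\<Sum>z\<in>U. v z)"
    by (rule member_le_sum) (use v True in \<open>auto simp: PV_def finite_U\<close>)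
  then show ?thesis using v by (simp add: PV_def)
qed (auto simp: PV_def)

lemma qprob_bounds: "\<omega> \<in> Omega \<Longrightarrow> 0 \<le> qprob \<omega> k x zs \<and> qprob \<omega> k x zs \<le> 1"
proof (induction zs arbitrary: k x)
  case (Cons z zs)
  have "0 \<le> \<omega> (k, x) z" "\<omega> (k, x) z \<le> 1"
    using Cons.prems by (auto simp: Omega_def PV_le_1) (auto simp: PV_def)
  with Cons.IH[OF Cons.prems] show ?case by (simp add: mult_le_one)
qed simp

section \<open>Retraction onto genuine environments\<close>

definition toPV :: "(int^'d::finite \<Rightarrow> real) \<Rightarrow> int^'d \<Rightarrow> real" where
  "toPV v = (if v \<in> PV then v else (\<lambda>z. if z = u0 then 1 else 0))"

text \<open>Almost every environment lies in \<open>Omega\<close>, but the bounds on path weights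
  and on \<open>f\<close> are available only there; composing with this retraction makes them hold
  everywhere. Since it acts on each site separately, it commutes with shifts and does not enlarge
  the set of sites that a functional reads.\<close>

definition toOmega :: "('d::finite) env \<Rightarrow> 'd env" where
  "toOmega \<omega> = (\<lambda>i. toPV (\<omega> i))"

lemma toPV_in_PV: "toPV v \<in> PV"
  unfolding toPV_def by (auto simp: PV_def finite_U u0_in_U)

lemma toOmega_in_Omega: "toOmega \<omega> \<in> Omega"
  by (simp add: Omega_def toOmega_def toPV_in_PV)

lemma toOmega_id: "\<omega> \<in> Omega \<Longrightarrow> toOmega \<omega> = \<omega>"
  by (auto simp: Omega_def toOmega_def toPV_def fun_eq_iff)

lemma toOmega_shift: "toOmega (shift m y \<omega>) = shift m y (toOmega \<omega>)"
  by (auto simp: toOmega_def shift_def fun_eq_iff)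

lemma PV_sets: "(PV :: (int^'d::finite \<Rightarrow> real) set) \<in> sets locM"
proof -
  have [measurable]: "(\<lambda>v. v z) \<in> borel_measurable (locM :: (int^'d \<Rightarrow> real) measure)" for z
    unfolding locM_def by (rule measurable_component_singleton) simp
  have "{v \<in> space (locM :: (int^'d \<Rightarrow> real) measure).
      (\<forall>z. 0 \<le> v z) \<and> (\<forall>z. z \<notin> U \<longrightarrow> v z = 0) \<and> (\<Sum>z\<in>U. v z) = 1} \<in> sets locM"
    by measurable
  moreover have "space (locM :: (int^'d \<Rightarrow> real) measure) = UNIV"
    by (simp add: locM_def space_PiM)
  ultimately show ?thesis by (simp add: PV_def)
qed

section \<open>The annealed functional\<close>

locale rwre = prob_space \<alpha> for \<alpha> :: "(int^'d::finite \<Rightarrow> real) measure" +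
  assumes sets_\<alpha>: "sets \<alpha> = sets locM" and AE_PV: "AE v in \<alpha>. v \<in> PV"
begin

sublocale env: prob_space "env_law \<alpha>"
  unfolding env_law_def by (rule prob_space_PiM) (rule prob_space_axioms)

lemma space_\<alpha>: "space \<alpha> = UNIV"
  using sets_eq_imp_space_eq[OF sets_\<alpha>] by (simp add: locM_def space_PiM)

lemma space_env: "space (env_law \<alpha>) = UNIV"
  by (simp add: env_law_def space_PiM space_\<alpha>)

lemma measurable_site [measurable]: "(\<lambda>\<omega>. \<omega> i) \<in> env_law \<alpha> \<rightarrow>\<^sub>M \<alpha>"
  unfolding env_law_def by (rule measurable_component_singleton) simp

lemma measurable_coord [measurable]: "(\<lambda>v. v z) \<in> borel_measurable \<alpha>"
proof -
  have "(\<lambda>v. v z) \<in> borel_measurable locM"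
    unfolding locM_def by (rule measurable_component_singleton) simp
  then show ?thesis by (simp add: measurable_cong_sets[OF sets_\<alpha> refl])
qed

lemma measurable_site_coord [measurable]: "(\<lambda>\<omega>. \<omega> i z) \<in> borel_measurable (env_law \<alpha>)"
  by (rule measurable_compose[OF measurable_site measurable_coord])

lemma PV_sets_\<alpha> [measurable]: "PV \<in> sets \<alpha>"
  using PV_sets sets_\<alpha> by simp

lemma measurable_toPV [measurable]: "toPV \<in> \<alpha> \<rightarrow>\<^sub>M \<alpha>"
  unfolding toPV_def[abs_def] using PV_sets_\<alpha>
  by (intro measurable_If) (auto simp: space_\<alpha>)

lemma measurable_toOmega [measurable]: "toOmega \<in> env_law \<alpha> \<rightarrow>\<^sub>M env_law \<alpha>"
proof -
  have "(\<lambda>\<omega>. \<lambda>i\<in>UNIV. toPV (\<omega> i)) \<in> env_law \<alpha> \<rightarrow>\<^sub>M PiM UNIV (\<lambda>_. \<alpha>)"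
    by measurable
  then show ?thesis by (simp add: toOmega_def[abs_def] env_law_def[symmetric] restrict_UNIV)
qed

lemma measurable_shift [measurable]: "shift m y \<in> env_law \<alpha> \<rightarrow>\<^sub>M env_law \<alpha>"
proof -
  have "(\<lambda>\<omega>. \<lambda>i\<in>UNIV. \<omega> (fst i + m, snd i + y)) \<in> env_law \<alpha> \<rightarrow>\<^sub>M PiM UNIV (\<lambda>_. \<alpha>)"
    by measurable
  then show ?thesis by (simp add: shift_def[abs_def] env_law_def[symmetric] case_prod_unfold restrict_UNIV)
qed

text \<open>A space-time translation is an injective relabelling of the sites of an i.i.d.
  product.\<close>

lemma distr_shift: "distr (env_law \<alpha>) (env_law \<alpha>) (shift m y) = env_law \<alpha>"
proof -
  have "distr (PiM UNIV (\<lambda>_. \<alpha>)) (PiM UNIV (\<lambda>_. \<alpha>))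
      (\<lambda>\<omega>. \<lambda>i\<in>UNIV. \<omega> (fst i + m, snd i + y)) = PiM UNIV (\<lambda>_. \<alpha>)"
    by (rule distr_PiM_reindex[where f = "\<lambda>i. (fst i + m, snd i + y)" and M = "\<lambda>_. \<alpha>"])
      (auto simp: inj_on_def prod_eq_iff prob_space_axioms)
  then show ?thesis by (simp add: shift_def[abs_def] env_law_def case_prod_unfold restrict_UNIV)
qed

lemma AE_Omega: "AE \<omega> in env_law \<alpha>. \<omega> \<in> Omega"
proof -
  have "AE \<omega> in env_law \<alpha>. \<omega> i \<in> PV" for i
    unfolding env_law_def
    by (rule AE_PiM_component) (auto simp: prob_space_axioms AE_PV)
  then have "AE \<omega> in env_law \<alpha>. \<forall>i. \<omega> i \<in> PV" by (simp add: AE_all_countable)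
  then show ?thesis by eventually_elim (auto simp: Omega_def)
qed

lemma Omega_sets: "Omega \<in> sets (env_law \<alpha>)"
proof -
  have "{\<omega> \<in> space (env_law \<alpha>). \<forall>i. \<omega> i \<in> PV} \<in> sets (env_law \<alpha>)" by measurable
  then show ?thesis by (simp add: Omega_def space_env)
qed

text \<open>Independence of disjoint families of sites in a form free of sub-sigma-algebras:
  locality is a pointwise congruence, and a function that reads only the sites in \<open>I\<close>
  factors through the restriction to \<open>I\<close>.\<close>

lemma indep_expectation:
  fixes h1 h2 :: "'d env \<Rightarrow> real"
  assumes m: "h1 \<in> borel_measurable (env_law \<alpha>)" "h2 \<in> borel_measurable (env_law \<alpha>)"
    and b: "\<And>\<omega>. \<bar>h1 \<omega>\<bar> \<le> C1" "\<And>\<omega>. \<bar>h2 \<omega>\<bar> \<le> C2"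
    and d1: "\<And>\<omega> \<omega>'. (\<And>i. i \<in> I1 \<Longrightarrow> \<omega> i = \<omega>' i) \<Longrightarrow> h1 \<omega> = h1 \<omega>'"
    and d2: "\<And>\<omega> \<omega>'. (\<And>i. i \<in> I2 \<Longrightarrow> \<omega> i = \<omega>' i) \<Longrightarrow> h2 \<omega> = h2 \<omega>'"
    and disj: "I1 \<inter> I2 = {}"
  shows "(\<integral>\<omega>. h1 \<omega> * h2 \<omega> \<partial>env_law \<alpha>) = (\<integral>\<omega>. h1 \<omega> \<partial>env_law \<alpha>) * (\<integral>\<omega>. h2 \<omega> \<partial>env_law \<alpha>)"
proof -
  have ind: "env.indep_vars (\<lambda>_. \<alpha>) (\<lambda>i \<omega>. \<omega> i) UNIV"
  proof (subst env.indep_vars_iff_distr_eq_PiM)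
    have "distr (env_law \<alpha>) \<alpha> (\<lambda>\<omega>. \<omega> i) = \<alpha>" for i
      unfolding env_law_def by (rule distr_PiM_component) (auto simp: prob_space_axioms)
    then show "distr (env_law \<alpha>) (Pi\<^sub>M UNIV (\<lambda>_. \<alpha>)) (\<lambda>x. \<lambda>i\<in>UNIV. x i) =
        Pi\<^sub>M UNIV (\<lambda>i. distr (env_law \<alpha>) \<alpha> (\<lambda>\<omega>. \<omega> i))"
      by (simp add: env_law_def restrict_UNIV)
  qed auto
  have var: "env.indep_var (PiM I1 (\<lambda>_. \<alpha>)) (\<lambda>\<omega>. restrict (\<lambda>i. \<omega> i) I1)
      (PiM I2 (\<lambda>_. \<alpha>)) (\<lambda>\<omega>. restrict (\<lambda>i. \<omega> i) I2)"
    by (rule env.indep_var_restrict[OF ind disj]) auto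
  define c :: "'d env" where "c = (\<lambda>_ _. 0)"
  \<comment> \<open>Rebuilds a full environment from its restriction to \<open>I\<close>. The filler
    \<open>c\<close> is arbitrary, because the functions composed with \<open>ext I1\<close> and
    \<open>ext I2\<close> do not read it.\<close>
  define ext where "ext I \<omega> = (\<lambda>i. if i \<in> I then \<omega> i else c i)" for I and \<omega> :: "'d env"
  have ext_m: "ext I \<in> PiM I (\<lambda>_. \<alpha>) \<rightarrow>\<^sub>M env_law \<alpha>" for I
  proof -
    have "(\<lambda>\<omega>. if i \<in> I then \<omega> i else c i) \<in> PiM I (\<lambda>_. \<alpha>) \<rightarrow>\<^sub>M \<alpha>" for i
      by (cases "i \<in> I") (auto simp: space_\<alpha>)
    then have "(\<lambda>\<omega>. \<lambda>i\<in>UNIV. if i \<in> I then \<omega> i else c i) \<in> PiM I (\<lambda>_. \<alpha>) \<rightarrow>\<^sub>M PiM UNIV (\<lambda>_. \<alpha>)"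
      by measurable
    then show ?thesis by (simp add: ext_def[abs_def] env_law_def restrict_UNIV)
  qed
  have "env.indep_var borel ((h1 \<circ> ext I1) \<circ> (\<lambda>\<omega>. restrict (\<lambda>i. \<omega> i) I1))
      borel ((h2 \<circ> ext I2) \<circ> (\<lambda>\<omega>. restrict (\<lambda>i. \<omega> i) I2))"
    by (rule env.indep_var_compose[OF var]) (rule measurable_comp[OF ext_m]; rule m)+
  moreover have "(h1 \<circ> ext I1) \<circ> (\<lambda>\<omega>. restrict (\<lambda>i. \<omega> i) I1) = h1"
    by (auto simp: fun_eq_iff ext_def intro!: d1)
  moreover have "(h2 \<circ> ext I2) \<circ> (\<lambda>\<omega>. restrict (\<lambda>i. \<omega> i) I2) = h2"
    by (auto simp: fun_eq_iff ext_def intro!: d2)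
  ultimately have iv: "env.indep_var borel h1 borel h2" by simp
  have "integrable (env_law \<alpha>) h1"
    by (rule env.integrable_const_bound[where B = C1]) (simp_all add: b m)
  moreover have "integrable (env_law \<alpha>) h2"
    by (rule env.integrable_const_bound[where B = C2]) (simp_all add: b m)
  ultimately show ?thesis using env.indep_var_lebesgue_integral[OF iv] by simp
qed

end

section \<open>Functionals of finitely many levels and steps\<close>

definition adapted :: "nat \<Rightarrow> ('d::finite env \<Rightarrow> (nat \<Rightarrow> int^'d) \<Rightarrow> real) \<Rightarrow> bool" where
  "adapted a F \<longleftrightarrow> (\<forall>\<omega> \<omega>' Z Z'. (\<forall>n\<in>{0..<int a}. \<forall>x. \<omega> (n, x) = \<omega>' (n, x)) \<longrightarrow>
     (\<forall>i\<in>{1..a}. Z i = Z' i) \<longrightarrow> F \<omega> Z = F \<omega>' Z')"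

lemma adaptedD:
  "adapted a F \<Longrightarrow> (\<And>n x. n \<in> {0..<int a} \<Longrightarrow> \<omega> (n, x) = \<omega>' (n, x)) \<Longrightarrow>
    (\<And>i. i \<in> {1..a} \<Longrightarrow> Z i = Z' i) \<Longrightarrow> F \<omega> Z = F \<omega>' Z'"
  unfolding adapted_def by blast

lemma adapted_const: "adapted a (\<lambda>_ _. c)"
  by (simp add: adapted_def)

lemma adapted_comp2:
  assumes "adapted a F" "adapted a G"
  shows "adapted a (\<lambda>\<omega> Z. h (F \<omega> Z) (G \<omega> Z))"
  unfolding adapted_def
proof (intro allI impI)
  fix \<omega> \<omega>' :: "'a env" and Z Z' :: "nat \<Rightarrow> int^'a"
  assume "\<forall>n\<in>{0..<int a}. \<forall>x. \<omega> (n, x) = \<omega>' (n, x)" "\<forall>i\<in>{1..a}. Z i = Z' i"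
  then have "F \<omega> Z = F \<omega>' Z'" "G \<omega> Z = G \<omega>' Z'"
    by (auto intro: adaptedD[OF assms(1)] adaptedD[OF assms(2)])
  then show "h (F \<omega> Z) (G \<omega> Z) = h (F \<omega>' Z') (G \<omega>' Z')" by simp
qed

text \<open>The functional applied to the environment and the steps as seen from the walk after
  \<open>a\<close> steps. Steps keep their numbering from 1; the passage to the numbering from 0
  used by \<open>f\<close> is made in \<open>localize\<close>.\<close>

definition moved :: "nat \<Rightarrow> ('d::finite env \<Rightarrow> (nat \<Rightarrow> int^'d) \<Rightarrow> 'b) \<Rightarrow> 'd env \<Rightarrow> (nat \<Rightarrow> int^'d) \<Rightarrow> 'b"
  where "moved a F \<omega> Z = F (shift (int a) (Xpos Z a) \<omega>) (\<lambda>i. Z (a + i))"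

lemma moved_moved: "moved a (moved b F) = moved (a + b) F"
  by (auto simp: moved_def fun_eq_iff shift_shift Xpos_add add_ac)

lemma moved_0 [simp]: "moved 0 F = F"
  by (auto simp: moved_def fun_eq_iff)

lemma adapted_moved:
  assumes "adapted b F"
  shows "adapted (a + b) (moved a F)"
  unfolding adapted_def moved_def
proof (intro allI impI)
  fix \<omega> \<omega>' :: "'a env" and Z Z' :: "nat \<Rightarrow> int^'a"
  assume *: "\<forall>n\<in>{0..<int (a + b)}. \<forall>x. \<omega> (n, x) = \<omega>' (n, x)" "\<forall>i\<in>{1..a + b}. Z i = Z' i"
  then have "Xpos Z a = Xpos Z' a" by (intro Xpos_cong) auto
  then show "F (shift (int a) (Xpos Z a) \<omega>) (\<lambda>i. Z (a + i))
      = F (shift (int a) (Xpos Z' a) \<omega>') (\<lambda>i. Z' (a + i))"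
    using * by (intro adaptedD[OF assms]) (auto simp: shift_def)
qed

lemma adapted_mono: "adapted a F \<Longrightarrow> a \<le> b \<Longrightarrow> adapted b F"
  unfolding adapted_def by simp

context rwre
begin

text \<open>The bound may depend on \<open>Z\<close>: a fixed horizon has finitely many paths, and
  functionals such as the tilting density can be unbounded over all step sequences.\<close>

definition regular :: "('d env \<Rightarrow> (nat \<Rightarrow> int^'d) \<Rightarrow> real) \<Rightarrow> bool" where
  "regular F \<longleftrightarrow> (\<forall>Z. (\<lambda>\<omega>. F \<omega> Z) \<in> borel_measurable (env_law \<alpha>) \<and> (\<exists>C. \<forall>\<omega>. \<bar>F \<omega> Z\<bar> \<le> C))"

text \<open>A total counterpart of \<open>annE\<close>. The path weight is taken at the retracted
  environment, so it lies between 0 and 1 for every \<open>\<omega>\<close>, not just almost every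
  one.\<close>

definition annI :: "nat \<Rightarrow> ('d env \<Rightarrow> (nat \<Rightarrow> int^'d) \<Rightarrow> real) \<Rightarrow> real" where
  "annI m F = (\<integral>\<omega>. (\<Sum>zs\<in>paths m. qprob (toOmega \<omega>) 0 0 zs * F \<omega> (stepseq zs)) \<partial>env_law \<alpha>)"

lemma regularD:
  assumes "regular F"
  shows "(\<lambda>\<omega>. F \<omega> Z) \<in> borel_measurable (env_law \<alpha>)" "\<exists>C. \<forall>\<omega>. \<bar>F \<omega> Z\<bar> \<le> C"
  using assms unfolding regular_def by auto

lemma regular_steps: "regular (\<lambda>\<omega> Z. g Z)"
  unfolding regular_def by auto

lemma regular_mult:
  assumes "regular F" "regular G"
  shows "regular (\<lambda>\<omega> Z. F \<omega> Z * G \<omega> Z)"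
  unfolding regular_def
proof (intro allI conjI)
  fix Z
  obtain C where C: "\<forall>\<omega>. \<bar>F \<omega> Z\<bar> \<le> C" using regularD(2)[OF assms(1)] by blast
  obtain D where D: "\<forall>\<omega>. \<bar>G \<omega> Z\<bar> \<le> D" using regularD(2)[OF assms(2)] by blast
  have "\<bar>F \<omega> Z * G \<omega> Z\<bar> \<le> C * D" for \<omega>
    unfolding abs_mult using C D order_trans[OF abs_ge_zero] by (intro mult_mono) blast+
  then show "\<exists>C. \<forall>\<omega>. \<bar>F \<omega> Z * G \<omega> Z\<bar> \<le> C" by blast
  show "(\<lambda>\<omega>. F \<omega> Z * G \<omega> Z) \<in> borel_measurable (env_law \<alpha>)"
    using assms[THEN regularD(1)] by measurable
qed

lemma regular_add:
  assumes "regular F" "regular G"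
  shows "regular (\<lambda>\<omega> Z. F \<omega> Z + G \<omega> Z)"
  unfolding regular_def
proof (intro allI conjI)
  fix Z
  obtain C where C: "\<forall>\<omega>. \<bar>F \<omega> Z\<bar> \<le> C" using regularD(2)[OF assms(1)] by blast
  obtain D where D: "\<forall>\<omega>. \<bar>G \<omega> Z\<bar> \<le> D" using regularD(2)[OF assms(2)] by blast
  have "\<bar>F \<omega> Z + G \<omega> Z\<bar> \<le> C + D" for \<omega>
    using C[rule_format, of \<omega>] D[rule_format, of \<omega>] by linarith
  then show "\<exists>C. \<forall>\<omega>. \<bar>F \<omega> Z + G \<omega> Z\<bar> \<le> C" by blast
  show "(\<lambda>\<omega>. F \<omega> Z + G \<omega> Z) \<in> borel_measurable (env_law \<alpha>)"
    using assms[THEN regularD(1)] by measurable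
qed

lemma regular_sum: "(\<And>i. i \<in> I \<Longrightarrow> regular (F i)) \<Longrightarrow> regular (\<lambda>\<omega> Z. \<Sum>i\<in>I. F i \<omega> Z)"
  by (induction I rule: infinite_finite_induct) (auto intro: regular_add regular_steps)

lemma regular_exp:
  assumes "regular F"
  shows "regular (\<lambda>\<omega> Z. exp (F \<omega> Z))"
  unfolding regular_def
proof (intro allI conjI)
  fix Z
  obtain C where C: "\<forall>\<omega>. \<bar>F \<omega> Z\<bar> \<le> C" using regularD(2)[OF assms] by blast
  then have "\<forall>\<omega>. \<bar>exp (F \<omega> Z)\<bar> \<le> exp C" by (auto simp: abs_le_iff)
  then show "\<exists>C. \<forall>\<omega>. \<bar>exp (F \<omega> Z)\<bar> \<le> C" by blast
  show "(\<lambda>\<omega>. exp (F \<omega> Z)) \<in> borel_measurable (env_law \<alpha>)"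
    using assms[THEN regularD(1)] by measurable
qed

lemma regular_indicator:
  assumes "\<And>Z. Measurable.pred (env_law \<alpha>) (\<lambda>\<omega>. P \<omega> Z)"
  shows "regular (\<lambda>\<omega> Z. if P \<omega> Z then 1 else 0)"
  unfolding regular_def
proof (intro allI conjI)
  fix Z
  show "(\<lambda>\<omega>. if P \<omega> Z then 1 else 0 :: real) \<in> borel_measurable (env_law \<alpha>)"
    using assms[of Z] by measurable
qed (auto intro!: exI[of _ 1])

lemma regular_moved: "regular F \<Longrightarrow> regular (moved a F)"
  unfolding regular_def moved_def by (fast intro: measurable_compose[OF measurable_shift])

lemma measurable_qprob [measurable]: "(\<lambda>\<omega>. qprob \<omega> k x zs) \<in> borel_measurable (env_law \<alpha>)"
  by (induction zs arbitrary: k x) simp_all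

lemma measurable_qprob_toOmega [measurable]:
  "(\<lambda>\<omega>. qprob (toOmega \<omega>) k x zs) \<in> borel_measurable (env_law \<alpha>)"
  by (rule measurable_compose[OF measurable_toOmega measurable_qprob])

lemma abs_qprob_le: "\<bar>qprob (toOmega \<omega>) k x zs\<bar> \<le> 1"
  using qprob_bounds[OF toOmega_in_Omega, of \<omega> k x zs] by simp

lemma path_term_bounded:
  assumes "regular F"
  obtains C where "\<And>\<omega>. \<bar>qprob (toOmega \<omega>) 0 0 zs * F \<omega> Z\<bar> \<le> C"
proof -
  obtain C where C: "\<forall>\<omega>. \<bar>F \<omega> Z\<bar> \<le> C" using regularD(2)[OF assms] by blast
  have "\<bar>qprob (toOmega \<omega>) 0 0 zs * F \<omega> Z\<bar> \<le> 1 * C" for \<omega>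
    unfolding abs_mult using C abs_qprob_le by (intro mult_mono) auto
  then show ?thesis using that by blast
qed

lemma path_term_measurable:
  assumes "regular F"
  shows "(\<lambda>\<omega>. qprob (toOmega \<omega>) 0 0 zs * F \<omega> Z) \<in> borel_measurable (env_law \<alpha>)"
  using regularD(1)[OF assms] by measurable

lemma path_term_integrable:
  assumes "regular F"
  shows "integrable (env_law \<alpha>) (\<lambda>\<omega>. qprob (toOmega \<omega>) 0 0 zs * F \<omega> Z)"
proof -
  obtain C where "\<And>\<omega>. \<bar>qprob (toOmega \<omega>) 0 0 zs * F \<omega> Z\<bar> \<le> C"
    using path_term_bounded[OF assms] by blast
  then show ?thesis
    by (intro env.integrable_const_bound[where B = C] path_term_measurable[OF assms]) auto
qed

lemma annI_eq:
  assumes "regular F"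
  shows "annI m F = (\<Sum>zs\<in>paths m. \<integral>\<omega>. qprob (toOmega \<omega>) 0 0 zs * F \<omega> (stepseq zs) \<partial>env_law \<alpha>)"
  unfolding annI_def by (rule Bochner_Integration.integral_sum) (rule path_term_integrable[OF assms])

lemma annI_add:
  "regular F \<Longrightarrow> regular G \<Longrightarrow> annI m (\<lambda>\<omega> Z. F \<omega> Z + G \<omega> Z) = annI m F + annI m G"
  by (simp add: annI_eq regular_add distrib_left path_term_integrable sum.distrib)

lemma annI_cmult: "annI m (\<lambda>\<omega> Z. c * F \<omega> Z) = c * annI m F"
  unfolding annI_def by (simp add: sum_distrib_left mult.left_commute flip: integral_mult_right_zero)

lemma annI_sum:
  "(\<And>i. i \<in> I \<Longrightarrow> regular (F i)) \<Longrightarrow> annI m (\<lambda>\<omega> Z. \<Sum>i\<in>I. F i \<omega> Z) = (\<Sum>i\<in>I. annI m (F i))"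
proof (induction I rule: infinite_finite_induct)
  case (insert i I)
  then show ?case by (simp add: annI_add regular_sum)
qed (simp_all add: annI_def)

lemma annI_mono:
  assumes "regular F" "regular G"
    and "\<And>\<omega> zs. \<omega> \<in> Omega \<Longrightarrow> zs \<in> paths m \<Longrightarrow> F \<omega> (stepseq zs) \<le> G \<omega> (stepseq zs)"
  shows "annI m F \<le> annI m G"
  unfolding annI_eq[OF assms(1)] annI_eq[OF assms(2)]
proof (intro sum_mono integral_mono_AE path_term_integrable assms)
  fix zs :: "(int^'d) list" assume "zs \<in> paths m"
  show "AE \<omega> in env_law \<alpha>. qprob (toOmega \<omega>) 0 0 zs * F \<omega> (stepseq zs)
      \<le> qprob (toOmega \<omega>) 0 0 zs * G \<omega> (stepseq zs)"
    using AE_Omega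
  proof eventually_elim
    case (elim \<omega>)
    then show ?case
      using assms(3)[OF elim \<open>zs \<in> paths m\<close>] qprob_bounds[OF toOmega_in_Omega]
      by (intro mult_left_mono) auto
  qed
qed

text \<open>The bridge from the definitions to the total calculus. \<open>F\<close> may be
  uncontrolled off \<open>Omega\<close>; the restriction to \<open>Omega\<close> in
  \<open>annE\<close> discards that part, and since \<open>Omega\<close> has full measure the
  regular substitute \<open>G\<close> gives the same value when integrated over the whole
  space.\<close>

lemma annE_eq_annI:
  assumes "regular G"
    and "\<And>\<omega> zs. \<omega> \<in> Omega \<Longrightarrow> zs \<in> paths m \<Longrightarrow> F \<omega> (stepseq zs) = G \<omega> (stepseq zs)"
  shows "annE \<alpha> m F = annI m G"
proof -
  let ?g = "\<lambda>\<omega>. \<Sum>zs\<in>paths m. qprob (toOmega \<omega>) 0 0 zs * G \<omega> (stepseq zs)"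
  have "annE \<alpha> m F = (\<integral>\<omega>. indicator Omega \<omega> *\<^sub>R ?g \<omega> \<partial>env_law \<alpha>)"
    unfolding annE_def set_lebesgue_integral_def
    by (intro Bochner_Integration.integral_cong refl)
      (auto simp: indicator_def toOmega_id assms(2) intro!: sum.cong)
  also have "\<dots> = annI m G" unfolding annI_def
  proof (intro integral_cong_AE)
    have [measurable]: "?g \<in> borel_measurable (env_law \<alpha>)"
      by (intro borel_measurable_sum path_term_measurable assms)
    show "?g \<in> borel_measurable (env_law \<alpha>)" by fact
    show "(\<lambda>\<omega>. indicator Omega \<omega> *\<^sub>R ?g \<omega>) \<in> borel_measurable (env_law \<alpha>)"
      using Omega_sets by measurable
    show "AE \<omega> in env_law \<alpha>. indicator Omega \<omega> *\<^sub>R ?g \<omega> = ?g \<omega>"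
      using AE_Omega by eventually_elim auto
  qed
  finally show ?thesis .
qed

text \<open>The walk visits each level once: the first \<open>a\<close> steps and the environment seen from the walk
  after them involve disjoint sets of levels.\<close>

lemma annI_mult_moved:
  assumes A: "adapted a A" "regular A" and B: "adapted b B" "regular B"
  shows "annI (a + b) (\<lambda>\<omega> Z. A \<omega> Z * moved a B \<omega> Z) = annI a A * annI b B"
proof -
  let ?h1 = "\<lambda>zs \<omega>. qprob (toOmega \<omega>) 0 0 zs * A \<omega> (stepseq zs)"
  let ?h2 = "\<lambda>zs \<omega>. qprob (toOmega \<omega>) 0 0 zs * B \<omega> (stepseq zs)"
  let ?F = "\<lambda>\<omega> Z. A \<omega> Z * moved a B \<omega> Z"
  have reg: "regular ?F"
    by (intro regular_mult regular_moved A B)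
  have split: "(\<integral>\<omega>. qprob (toOmega \<omega>) 0 0 (zs @ zs') * ?F \<omega> (stepseq (zs @ zs')) \<partial>env_law \<alpha>)
      = (\<integral>\<omega>. ?h1 zs \<omega> \<partial>env_law \<alpha>) * (\<integral>\<omega>. ?h2 zs' \<omega> \<partial>env_law \<alpha>)"
    if zs: "zs \<in> paths a" and zs': "zs' \<in> paths b" for zs zs' :: "(int^'d) list"
  proof -
    have len: "length zs = a" "length zs' = b" using zs zs' by (auto simp: paths_def)
    \<comment> \<open>Once the path is fixed, the position after \<open>a\<close> steps is
      deterministic. Recentring there is then a fixed shift, under which the environment law is
      invariant.\<close>
    let ?x = "sum_list zs"
    have X: "Xpos (stepseq (zs @ zs')) a = ?x"
    proof -
      have "Xpos (stepseq (zs @ zs')) a = Xpos (stepseq zs) a"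
        by (rule Xpos_cong) (auto simp: stepseq_eq len nth_append)
      then show ?thesis using Xpos_stepseq[of zs] len by simp
    qed
    have eqA: "A \<omega> (stepseq (zs @ zs')) = A \<omega> (stepseq zs)" for \<omega>
      by (rule adaptedD[OF A(1)]) (auto simp: stepseq_eq len nth_append)
    have eqB: "moved a B \<omega> (stepseq (zs @ zs')) = B (shift (int a) ?x \<omega>) (stepseq zs')" for \<omega>
      unfolding moved_def X by (rule adaptedD[OF B(1)]) (auto simp: stepseq_eq len nth_append)
    have eq: "qprob (toOmega \<omega>) 0 0 (zs @ zs') * ?F \<omega> (stepseq (zs @ zs'))
        = ?h1 zs \<omega> * ?h2 zs' (shift (int a) ?x \<omega>)" for \<omega>
      by (simp add: eqA eqB qprob_append toOmega_shift qprob_shift len)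
    obtain C1 where C1: "\<And>\<omega>. \<bar>?h1 zs \<omega>\<bar> \<le> C1" using path_term_bounded[OF A(2)] by blast
    obtain C2 where C2: "\<And>\<omega>. \<bar>?h2 zs' \<omega>\<bar> \<le> C2" using path_term_bounded[OF B(2)] by blast
    have "(\<integral>\<omega>. ?h1 zs \<omega> * ?h2 zs' (shift (int a) ?x \<omega>) \<partial>env_law \<alpha>)
        = (\<integral>\<omega>. ?h1 zs \<omega> \<partial>env_law \<alpha>) * (\<integral>\<omega>. ?h2 zs' (shift (int a) ?x \<omega>) \<partial>env_law \<alpha>)"
    proof (rule indep_expectation[where ?I1.0 = "{0..<int a} \<times> UNIV"
          and ?I2.0 = "{int a..<int (a + b)} \<times> UNIV"])
      show "?h1 zs \<in> borel_measurable (env_law \<alpha>)"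
        by (rule path_term_measurable[OF A(2)])
      show "(\<lambda>\<omega>. ?h2 zs' (shift (int a) ?x \<omega>)) \<in> borel_measurable (env_law \<alpha>)"
        by (rule measurable_compose[OF measurable_shift path_term_measurable[OF B(2)]])
      show "\<bar>?h1 zs \<omega>\<bar> \<le> C1" "\<bar>?h2 zs' (shift (int a) ?x \<omega>)\<bar> \<le> C2" for \<omega> using C1 C2 by auto
      show "?h1 zs \<omega> = ?h1 zs \<omega>'"
        if "\<And>i. i \<in> {0..<int a} \<times> UNIV \<Longrightarrow> \<omega> i = \<omega>' i" for \<omega> \<omega>'
      proof -
        have "A \<omega> (stepseq zs) = A \<omega>' (stepseq zs)"
          using that by (intro adaptedD[OF A(1)]) auto
        moreover have "qprob (toOmega \<omega>) 0 0 zs = qprob (toOmega \<omega>') 0 0 zs"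
          using that by (intro qprob_cong) (auto simp: len toOmega_def)
        ultimately show ?thesis by simp
      qed
      show "?h2 zs' (shift (int a) ?x \<omega>) = ?h2 zs' (shift (int a) ?x \<omega>')"
        if "\<And>i. i \<in> {int a..<int (a + b)} \<times> UNIV \<Longrightarrow> \<omega> i = \<omega>' i" for \<omega> \<omega>'
      proof -
        have "B (shift (int a) ?x \<omega>) (stepseq zs') = B (shift (int a) ?x \<omega>') (stepseq zs')"
          using that by (intro adaptedD[OF B(1)]) (auto simp: shift_def)
        moreover have "qprob (toOmega (shift (int a) ?x \<omega>)) 0 0 zs'
            = qprob (toOmega (shift (int a) ?x \<omega>')) 0 0 zs'"
          using that by (intro qprob_cong) (auto simp: len toOmega_def shift_def)
        ultimately show ?thesis by simp
      qed
    qed auto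
    also have "(\<integral>\<omega>. ?h2 zs' (shift (int a) ?x \<omega>) \<partial>env_law \<alpha>)
        = (\<integral>\<omega>. ?h2 zs' \<omega> \<partial>distr (env_law \<alpha>) (env_law \<alpha>) (shift (int a) ?x))"
      by (rule integral_distr[symmetric, OF measurable_shift path_term_measurable[OF B(2)]])
    also have "\<dots> = (\<integral>\<omega>. ?h2 zs' \<omega> \<partial>env_law \<alpha>)" by (simp only: distr_shift)
    finally show ?thesis by (simp only: eq)
  qed
  have "annI (a + b) ?F = (\<Sum>zs\<in>paths a. \<Sum>zs'\<in>paths b.
      (\<integral>\<omega>. ?h1 zs \<omega> \<partial>env_law \<alpha>) * (\<integral>\<omega>. ?h2 zs' \<omega> \<partial>env_law \<alpha>))"
    unfolding annI_eq[OF reg] sum_paths_add by (intro sum.cong refl split)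
  also have "\<dots> = annI a A * annI b B"
    unfolding annI_eq[OF A(2)] annI_eq[OF B(2)] by (simp add: sum_product)
  finally show ?thesis .
qed

end

section \<open>The exponentially tilted functional\<close>

lemma rvec_add: "rvec (x + y) = rvec x + rvec y"
  by (simp add: rvec_def vec_eq_iff)

lemma rvec_0: "rvec 0 = 0"
  by (simp add: rvec_def vec_eq_iff)

lemma adapted_prod:
  assumes "\<And>i. i \<in> I \<Longrightarrow> adapted a (F i)"
  shows "adapted a (\<lambda>\<omega> Z. \<Prod>i\<in>I. F i \<omega> Z)"
  using assms
proof (induction I rule: infinite_finite_induct)
  case (insert i I)
  then show ?case by (auto intro: adapted_comp2[where h = "(*)"])
qed (simp_all add: adapted_const)

lemma moved_prod: "moved a (\<lambda>\<omega> Z. \<Prod>i\<in>I. F i \<omega> Z) = (\<lambda>\<omega> Z. \<Prod>i\<in>I. moved a (F i) \<omega> Z)"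
  by (simp add: moved_def fun_eq_iff)

text \<open>Besides the remainder one full block is given up: with \<open>p = n div L - 1\<close>
  and \<open>r < L\<close> one has \<open>r + p * L \<le> n\<close>, so every window of length
  \<open>L\<close> that is kept ends within the first \<open>n\<close> levels. This leaves out at
  most \<open>2 * L\<close> terms.\<close>

lemma block_sum_bound:
  fixes g :: "nat \<Rightarrow> real"
  assumes L: "0 < L" "L \<le> n" and g: "\<And>i. \<bar>g i\<bar> \<le> D"
  shows "\<bar>\<Sum>i<n. g i\<bar> \<le> (\<Sum>r<L. \<bar>\<Sum>k<n div L - 1. g (r + k * L)\<bar>) + 2 * real L * D"
proof -
  define p where "p = n div L - 1"
  have "1 \<le> n div L" using L by (simp add: div_greater_zero_iff Suc_leI)
  then have p: "Suc p = n div L" by (simp add: p_def)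
  have pn: "p * L \<le> n" "n - p * L \<le> 2 * L"
  proof -
    have "n = Suc p * L + n mod L" unfolding p by (simp add: div_mult_mod_eq)
    moreover have "n mod L < L" using L by simp
    ultimately show "p * L \<le> n" "n - p * L \<le> 2 * L" by auto
  qed
  have "(\<Sum>i<p * L. g i) = (\<Sum>k<p. \<Sum>i=k * L..<k * L + L. g i)" by (rule sum.nat_group[symmetric])
  also have "\<dots> = (\<Sum>k<p. \<Sum>r<L. g (r + k * L))"
  proof (rule sum.cong[OF refl])
    fix k show "(\<Sum>i=k * L..<k * L + L. g i) = (\<Sum>r<L. g (r + k * L))"
      by (rule sum.reindex_bij_witness[where i = "\<lambda>r. r + k * L" and j = "\<lambda>i. i - k * L"]) auto
  qed
  also have "\<dots> = (\<Sum>r<L. \<Sum>k<p. g (r + k * L))" by (rule sum.swap)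
  finally have main: "\<bar>\<Sum>i<p * L. g i\<bar> \<le> (\<Sum>r<L. \<bar>\<Sum>k<p. g (r + k * L)\<bar>)" by simp
  have "{..<n} = {..<p * L} \<union> {p * L..<n}" using pn by auto
  then have "(\<Sum>i<n. g i) = (\<Sum>i<p * L. g i) + (\<Sum>i=p * L..<n. g i)"
    by (simp add: sum.union_disjoint ivl_disj_int_one)
  moreover have "\<bar>\<Sum>i=p * L..<n. g i\<bar> \<le> 2 * real L * D"
  proof -
    have "0 \<le> D" using g[of 0] by simp
    have "\<bar>\<Sum>i=p * L..<n. g i\<bar> \<le> (\<Sum>i=p * L..<n. D)"
      by (rule order_trans[OF sum_abs]) (intro sum_mono g)
    also have "\<dots> = real (n - p * L) * D" by simp
    also have "\<dots> \<le> real (2 * L) * D" using pn \<open>0 \<le> D\<close> by (intro mult_right_mono) (auto simp only: of_nat_le_iff)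
    finally show ?thesis by simp
  qed
  ultimately show ?thesis using main unfolding p_def by linarith
qed

lemma exp_le_quadratic:
  fixes x :: real
  assumes "\<bar>x\<bar> \<le> 1"
  shows "exp x \<le> 1 + x + x\<^sup>2"
proof (cases "0 \<le> x")
  case True
  then show ?thesis using exp_bound[of x] assms by simp
next
  case False
  define y where "y = - x"
  have y: "0 \<le> y" "y \<le> 1" using False assms by (auto simp: y_def)
  have "1 + y \<le> exp y" by (rule exp_ge_add_one_self)
  then have "exp (- y) \<le> 1 / (1 + y)" using y by (simp add: exp_minus divide_simps)
  also have "\<dots> \<le> 1 - y + y\<^sup>2"
  proof -
    \<comment> \<open>The product on the right equals 1 plus the cube of \<open>y\<close>.\<close>
    have "1 \<le> (1 - y + y\<^sup>2) * (1 + y)" using y by (simp add: algebra_simps power2_eq_square)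
    then show ?thesis using y by (simp add: divide_simps)
  qed
  finally show ?thesis by (simp add: y_def)
qed

locale elliptic_rwre = rwre \<alpha> for \<alpha> :: "(int^'d::finite \<Rightarrow> real) measure" +
  fixes c1 :: real
  assumes c1_pos: "0 < c1" and elliptic: "AE v in \<alpha>. \<forall>z\<in>U. c1 \<le> v z"
begin

lemma integrable_site: "integrable (env_law \<alpha>) (\<lambda>\<omega>. \<omega> i z)"
proof (rule env.integrable_const_bound[where B = 1])
  show "AE \<omega> in env_law \<alpha>. norm (\<omega> i z) \<le> 1"
    using AE_Omega
  proof eventually_elim
    case (elim \<omega>)
    then have "\<omega> i \<in> PV" by (cases i) (simp add: Omega_def)
    then show ?case using PV_le_1[of "\<omega> i" z] by (auto simp: PV_def)
  qed
qed simp

lemma qmean_ge: "z \<in> U \<Longrightarrow> c1 \<le> qmean \<alpha> z"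
proof -
  assume z: "z \<in> U"
  have "AE \<omega> in env_law \<alpha>. c1 \<le> \<omega> (0, 0) z"
    unfolding env_law_def
  proof (rule AE_PiM_component)
    show "AE v in \<alpha>. c1 \<le> v z" using elliptic by eventually_elim (use z in auto)
  qed (auto simp: prob_space_axioms)
  then have "(\<integral>\<omega>. c1 \<partial>env_law \<alpha>) \<le> (\<integral>\<omega>. \<omega> (0, 0) z \<partial>env_law \<alpha>)"
    by (intro integral_mono_AE integrable_site) auto
  then show ?thesis by (simp add: qmean_def env.prob_space)
qed

lemma qmean_pos: "z \<in> U \<Longrightarrow> 0 < qmean \<alpha> z"
  using qmean_ge[of z] c1_pos by linarith

lemma mgf_pos: "0 < (\<Sum>z\<in>U. qmean \<alpha> z * exp (\<theta> \<bullet> rvec z))"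
  by (intro sum_pos) (use finite_U u0_in_U qmean_pos in auto)

lemma exp_Lambda_c: "exp (Lambda_c \<alpha> \<theta>) = (\<Sum>z\<in>U. qmean \<alpha> z * exp (\<theta> \<bullet> rvec z))"
  unfolding Lambda_c_def by (simp add: mgf_pos)

lemma tilted_mass: "(\<Sum>z\<in>U. qmean \<alpha> z * exp (\<theta> \<bullet> rvec z - Lambda_c \<alpha> \<theta>)) = 1"
  using mgf_pos[of \<theta>]
  by (simp add: exp_diff exp_Lambda_c sum_divide_distrib[symmetric])

lemma annI_step: "annI 1 (\<lambda>\<omega> Z. g (Z 1)) = (\<Sum>z\<in>U. qmean \<alpha> z * g z)"
proof -
  have "annI 1 (\<lambda>\<omega> Z. g (Z 1))
      = (\<Sum>zs\<in>paths 1. \<integral>\<omega>. qprob (toOmega \<omega>) 0 0 zs * g (stepseq zs 1) \<partial>env_law \<alpha>)"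
    by (rule annI_eq) (rule regular_steps)
  also have "\<dots> = (\<Sum>z\<in>U. qmean \<alpha> z * g z)"
  proof (rule sum.reindex_bij_witness[where i = "\<lambda>z. [z]" and j = hd])
    fix zs :: "(int^'d) list" assume "zs \<in> paths 1"
    then obtain z where zs: "zs = [z]" by (auto simp: paths_def length_Suc_conv)
    have m: "(\<lambda>\<omega>. toOmega \<omega> (0, 0) z) \<in> borel_measurable (env_law \<alpha>)"
      by (rule measurable_compose[OF measurable_toOmega measurable_site_coord])
    have "(\<integral>\<omega>. toOmega \<omega> (0, 0) z \<partial>env_law \<alpha>) = qmean \<alpha> z"
      unfolding qmean_def
      by (rule integral_cong_AE[OF m measurable_site_coord])
        (use AE_Omega in eventually_elim, simp add: toOmega_id)
    then show "qmean \<alpha> (hd zs) * g (hd zs)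
        = (\<integral>\<omega>. qprob (toOmega \<omega>) 0 0 zs * g (stepseq zs 1) \<partial>env_law \<alpha>)"
      by (simp add: zs stepseq_eq)
  qed (auto simp: paths_def length_Suc_conv)
  finally show ?thesis .
qed

definition tilt :: "real^'d \<Rightarrow> nat \<Rightarrow> (nat \<Rightarrow> int^'d) \<Rightarrow> real" where
  "tilt \<theta> m Z = exp (\<theta> \<bullet> rvec (Xpos Z m) - real m * Lambda_c \<alpha> \<theta>)"

text \<open>The expectation under the exponential (Cramer) change of measure. Keeping it as a
  functional with an explicit horizon \<open>m\<close> avoids the construction of a measure on
  infinite paths.\<close>

definition tiltI :: "real^'d \<Rightarrow> nat \<Rightarrow> ('d env \<Rightarrow> (nat \<Rightarrow> int^'d) \<Rightarrow> real) \<Rightarrow> real" where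
  "tiltI \<theta> m F = annI m (\<lambda>\<omega> Z. tilt \<theta> m Z * F \<omega> Z)"

lemma tilt_add: "tilt \<theta> (a + b) Z = tilt \<theta> a Z * tilt \<theta> b (\<lambda>i. Z (a + i))"
  by (simp add: tilt_def Xpos_add rvec_add inner_add_right algebra_simps flip: exp_add)

lemma tilt_pos: "0 < tilt \<theta> m Z"
  by (simp add: tilt_def)

lemma adapted_tilt: "adapted m (\<lambda>_. tilt \<theta> m)"
  unfolding adapted_def tilt_def using Xpos_cong[of m] by metis

lemma tiltI_mult_moved:
  assumes A: "adapted a A" "regular A" and B: "adapted b B" "regular B"
  shows "tiltI \<theta> (a + b) (\<lambda>\<omega> Z. A \<omega> Z * moved a B \<omega> Z) = tiltI \<theta> a A * tiltI \<theta> b B"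
proof -
  have "(\<lambda>\<omega> Z. tilt \<theta> (a + b) Z * (A \<omega> Z * moved a B \<omega> Z))
      = (\<lambda>\<omega> Z. (tilt \<theta> a Z * A \<omega> Z) * moved a (\<lambda>\<omega> Z. tilt \<theta> b Z * B \<omega> Z) \<omega> Z)"
    by (simp add: fun_eq_iff tilt_add moved_def)
  then show ?thesis unfolding tiltI_def
    using annI_mult_moved[of a "\<lambda>\<omega> Z. tilt \<theta> a Z * A \<omega> Z" b "\<lambda>\<omega> Z. tilt \<theta> b Z * B \<omega> Z"]
    by (simp add: A B adapted_comp2[where h = "(*)"] adapted_tilt regular_mult regular_steps)
qed

lemma tiltI_step: "tiltI \<theta> 1 (\<lambda>\<omega> Z. g (Z 1))
    = (\<Sum>z\<in>U. qmean \<alpha> z * exp (\<theta> \<bullet> rvec z - Lambda_c \<alpha> \<theta>) * g z)"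
proof -
  have "tiltI \<theta> 1 (\<lambda>\<omega> Z. g (Z 1))
      = annI 1 (\<lambda>\<omega> Z. exp (\<theta> \<bullet> rvec (Z 1) - Lambda_c \<alpha> \<theta>) * g (Z 1))"
    by (simp add: tiltI_def tilt_def Xpos_def)
  then show ?thesis
    using annI_step[of "\<lambda>z. exp (\<theta> \<bullet> rvec z - Lambda_c \<alpha> \<theta>) * g z"] by (simp add: mult.assoc)
qed

text \<open>Steps split off one at a time, each with mass one by \<open>tilted_mass\<close>; this is
  what lets \<open>tiltI\<close> be treated as an expectation at every horizon.\<close>

lemma tiltI_1: "tiltI \<theta> m (\<lambda>_ _. 1) = 1"
proof (induction m)
  case 0
  have "paths 0 = {[] :: (int^'d) list}" by (auto simp: paths_def)
  then show ?case by (simp add: tiltI_def annI_def tilt_def rvec_0 env.prob_space)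
next
  case (Suc m)
  have "tiltI \<theta> (1 + m) (\<lambda>\<omega> Z. 1 * moved 1 (\<lambda>_ _. 1) \<omega> Z)
      = tiltI \<theta> 1 (\<lambda>_ _. 1) * tiltI \<theta> m (\<lambda>_ _. 1)"
    by (rule tiltI_mult_moved) (simp_all add: adapted_const regular_steps)
  moreover have "tiltI \<theta> 1 (\<lambda>_ _. 1) = 1"
    using tiltI_step[of \<theta> "\<lambda>_. 1"] by (simp add: tilted_mass)
  ultimately show ?case using Suc by (simp add: moved_def)
qed

lemma tiltI_add:
  "regular F \<Longrightarrow> regular G \<Longrightarrow> tiltI \<theta> m (\<lambda>\<omega> Z. F \<omega> Z + G \<omega> Z) = tiltI \<theta> m F + tiltI \<theta> m G"
  by (simp add: tiltI_def distrib_left annI_add regular_mult regular_steps)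

lemma tiltI_cmult: "tiltI \<theta> m (\<lambda>\<omega> Z. c * F \<omega> Z) = c * tiltI \<theta> m F"
  by (simp add: tiltI_def mult.left_commute[of _ c] annI_cmult)

lemma tiltI_const: "tiltI \<theta> m (\<lambda>_ _. c) = c"
  using tiltI_cmult[of \<theta> m c "\<lambda>_ _. 1"] by (simp add: tiltI_1)

lemma tiltI_sum:
  "(\<And>i. i \<in> I \<Longrightarrow> regular (F i)) \<Longrightarrow>
    tiltI \<theta> m (\<lambda>\<omega> Z. \<Sum>i\<in>I. F i \<omega> Z) = (\<Sum>i\<in>I. tiltI \<theta> m (F i))"
  by (simp add: tiltI_def sum_distrib_left annI_sum regular_mult regular_steps)

lemma tiltI_mono:
  assumes "regular F" "regular G"
    and "\<And>\<omega> zs. \<omega> \<in> Omega \<Longrightarrow> zs \<in> paths m \<Longrightarrow> F \<omega> (stepseq zs) \<le> G \<omega> (stepseq zs)"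
  shows "tiltI \<theta> m F \<le> tiltI \<theta> m G"
  unfolding tiltI_def
  by (intro annI_mono regular_mult regular_steps assms(1,2))
    (intro mult_left_mono assms(3) less_imp_le[OF tilt_pos])

text \<open>Stationarity of the environment seen from the tilted walk: the first \<open>a\<close>
  steps factor off with total mass one.\<close>

lemma tiltI_moved:
  assumes "adapted b F" "regular F" "a + b = m"
  shows "tiltI \<theta> m (moved a F) = tiltI \<theta> b F"
  using tiltI_mult_moved[of a "\<lambda>_ _. 1" b F \<theta>] assms by (simp add: adapted_const regular_steps tiltI_1)

lemma regular_prod: "(\<And>i. i \<in> I \<Longrightarrow> regular (F i)) \<Longrightarrow> regular (\<lambda>\<omega> Z. \<Prod>i\<in>I. F i \<omega> Z)"
  by (induction I rule: infinite_finite_induct) (auto intro: regular_mult regular_steps)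

section \<open>Independent blocks and Chernoff bounds\<close>

lemma adapted_block_prod:
  assumes "adapted L G"
  shows "adapted (p * L + b) (\<lambda>\<omega> Z. \<Prod>k<p. moved (k * L) G \<omega> Z)"
proof (rule adapted_prod)
  fix k assume "k \<in> {..<p}"
  then have "Suc k * L \<le> p * L" by (intro mult_right_mono) auto
  then show "adapted (p * L + b) (moved (k * L) G)"
    by (intro adapted_mono[OF adapted_moved[OF assms]]) auto
qed

text \<open>Windows of length \<open>L\<close> whose starting times are multiples of
  \<open>L\<close> apart, up to the offset \<open>r\<close>, are disjoint, so the factors are
  independent and identically distributed.\<close>

lemma tiltI_block_prod:
  assumes G: "adapted L G" "regular G" and m: "r + p * L \<le> m"
  shows "tiltI \<theta> m (\<lambda>\<omega> Z. \<Prod>k<p. moved (r + k * L) G \<omega> Z) = tiltI \<theta> L G ^ p"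
proof -
  \<comment> \<open>The slack \<open>b\<close> is the part of the horizon behind the last block.
    Blocks are peeled off at the front, and what remains is the same product translated by
    \<open>L\<close>.\<close>
  have 0: "tiltI \<theta> (p * L + b) (\<lambda>\<omega> Z. \<Prod>k<p. moved (k * L) G \<omega> Z) = tiltI \<theta> L G ^ p" for p b
  proof (induction p)
    case 0
    then show ?case by (simp add: tiltI_1)
  next
    case (Suc p)
    let ?P = "\<lambda>\<omega> Z. \<Prod>k<p. moved (k * L) G \<omega> Z"
    have "moved L ?P = (\<lambda>\<omega> Z. \<Prod>k<p. moved (Suc k * L) G \<omega> Z)"
      by (simp add: moved_prod moved_moved)
    then have "(\<lambda>\<omega> Z. \<Prod>k<Suc p. moved (k * L) G \<omega> Z) = (\<lambda>\<omega> Z. G \<omega> Z * moved L ?P \<omega> Z)"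
      unfolding prod.lessThan_Suc_shift by simp
    moreover have "tiltI \<theta> (L + (p * L + b)) (\<lambda>\<omega> Z. G \<omega> Z * moved L ?P \<omega> Z)
        = tiltI \<theta> L G * tiltI \<theta> (p * L + b) ?P"
      by (intro tiltI_mult_moved G adapted_block_prod regular_prod regular_moved)
    ultimately show ?case using Suc by (simp add: add.assoc)
  qed
  obtain b where b: "m = r + (p * L + b)" using m by (metis add.assoc le_Suc_ex)
  let ?P = "\<lambda>\<omega> Z. \<Prod>k<p. moved (k * L) G \<omega> Z"
  have "(\<lambda>\<omega> Z. \<Prod>k<p. moved (r + k * L) G \<omega> Z) = moved r ?P"
    by (simp add: moved_prod moved_moved)
  then have "tiltI \<theta> m (\<lambda>\<omega> Z. \<Prod>k<p. moved (r + k * L) G \<omega> Z) = tiltI \<theta> (p * L + b) ?P"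
    using b by (simp add: tiltI_moved[of "p * L + b"] G adapted_block_prod regular_prod regular_moved)
  then show ?thesis by (simp add: 0)
qed

lemma tiltI_abs_le:
  assumes "regular Y" "\<And>\<omega> Z. \<bar>Y \<omega> Z\<bar> \<le> B"
  shows "\<bar>tiltI \<theta> m Y\<bar> \<le> B"
proof -
  have "Y \<omega> Z \<le> B" "- B \<le> Y \<omega> Z" for \<omega> Z using assms(2)[of \<omega> Z] by auto
  then have "tiltI \<theta> m Y \<le> tiltI \<theta> m (\<lambda>_ _. B)" "tiltI \<theta> m (\<lambda>_ _. - B) \<le> tiltI \<theta> m Y"
    by (auto intro!: tiltI_mono assms regular_steps)
  then show ?thesis by (simp add: tiltI_const)
qed

text \<open>The centred variable is bounded by \<open>2 * B\<close>. In the quadratic bound for the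
  exponential its linear term has tilted mean zero, so each block contributes at most 1 plus the
  square of \<open>s * (2 * B)\<close>, and blocks multiply.\<close>

lemma mgf_block_bound:
  assumes Y: "adapted L Y" "regular Y" "\<And>\<omega> Z. \<bar>Y \<omega> Z\<bar> \<le> B"
    and s: "\<bar>s\<bar> * (2 * B) \<le> 1" and m: "r + p * L \<le> m"
  shows "tiltI \<theta> m (\<lambda>\<omega> Z. exp (s * (\<Sum>k<p. moved (r + k * L) Y \<omega> Z - tiltI \<theta> L Y)))
    \<le> exp (real p * (s * (2 * B))\<^sup>2)"
proof -
  define \<mu> where "\<mu> = tiltI \<theta> L Y"
  let ?G = "\<lambda>\<omega> Z. exp (s * (Y \<omega> Z + - \<mu>))"
  have regG: "regular ?G"
    by (intro regular_exp regular_mult regular_add regular_steps Y)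
  have adG: "adapted L ?G"
    using adapted_comp2[OF Y(1) Y(1), where h = "\<lambda>y _. exp (s * (y + - \<mu>))"] .
  have "(\<lambda>\<omega> Z. exp (s * (\<Sum>k<p. moved (r + k * L) Y \<omega> Z - \<mu>)))
      = (\<lambda>\<omega> Z. \<Prod>k<p. moved (r + k * L) ?G \<omega> Z)"
    by (simp add: fun_eq_iff moved_def sum_distrib_left exp_sum)
  then have eq: "tiltI \<theta> m (\<lambda>\<omega> Z. exp (s * (\<Sum>k<p. moved (r + k * L) Y \<omega> Z - \<mu>)))
      = tiltI \<theta> L ?G ^ p"
    by (simp only: tiltI_block_prod[OF adG regG m])
  let ?q = "(s * (2 * B))\<^sup>2"
  have "tiltI \<theta> L ?G \<le> tiltI \<theta> L (\<lambda>\<omega> Z. s * Y \<omega> Z + (1 - s * \<mu> + ?q))"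
  proof (intro tiltI_mono regG regular_add regular_mult regular_steps Y)
    fix \<omega> and zs :: "(int^'d) list"
    let ?y = "Y \<omega> (stepseq zs) + - \<mu>"
    have "\<bar>?y\<bar> \<le> 2 * B"
      using Y(3)[of \<omega> "stepseq zs"] tiltI_abs_le[OF Y(2,3), of \<theta> L] unfolding \<mu>_def by linarith
    then have *: "\<bar>s * ?y\<bar> \<le> \<bar>s\<bar> * (2 * B)" unfolding abs_mult by (intro mult_left_mono) auto
    then have "exp (s * ?y) \<le> 1 + s * ?y + (s * ?y)\<^sup>2" using s by (intro exp_le_quadratic) auto
    also have "(s * ?y)\<^sup>2 \<le> ?q"
    proof -
      have "0 \<le> B" using Y(3) abs_ge_zero order_trans by blast
      then have "\<bar>s * ?y\<bar> \<le> \<bar>s * (2 * B)\<bar>" using * by (simp add: abs_mult)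
      then show ?thesis by (simp only: abs_le_square_iff)
    qed
    finally show "exp (s * ?y) \<le> s * Y \<omega> (stepseq zs) + (1 - s * \<mu> + ?q)"
      by (simp add: algebra_simps)
  qed
  also have "\<dots> = 1 + ?q"
    by (simp add: tiltI_add regular_mult regular_steps Y tiltI_cmult tiltI_const \<mu>_def)
  also have "\<dots> \<le> exp ?q" by (rule exp_ge_add_one_self)
  finally have le: "tiltI \<theta> L ?G \<le> exp ?q" .
  moreover have "0 \<le> tiltI \<theta> L ?G"
    using tiltI_mono[OF regular_steps[of "\<lambda>_. 0"] regG, of L \<theta>] by (simp add: tiltI_const)
  ultimately have "tiltI \<theta> L ?G ^ p \<le> exp ?q ^ p" by (intro power_mono)
  then show ?thesis unfolding \<mu>_def[symmetric] eq by (simp add: exp_of_nat_mult)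
qed

end

context elliptic_rwre
begin

text \<open>Consecutive summands overlap, so Chernoff's bound is applied in each of the
  \<open>L\<close> residue classes separately. The factor \<open>2 * real L\<close> counts the
  classes and the two signs of the deviation.\<close>

lemma tiltI_concentration:
  assumes Y: "adapted L Y" "regular Y" "\<And>\<omega> Z. \<bar>Y \<omega> Z\<bar> \<le> B" and L: "0 < L" and \<epsilon>: "0 < \<epsilon>"
  obtains c n0 where "0 < c" and "\<And>n m. n0 \<le> n \<Longrightarrow> n \<le> m \<Longrightarrow>
    tiltI \<theta> m (\<lambda>\<omega> Z. if \<epsilon> * real n < \<bar>(\<Sum>i<n. moved i Y \<omega> Z) - real n * tiltI \<theta> L Y\<bar> then 1 else 0)
      \<le> 2 * real L * exp (- c * real n)"
proof -
  define D where "D = max 1 (2 * B)"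
  define \<mu> where "\<mu> = tiltI \<theta> L Y"
  \<comment> \<open>The first bound keeps the exponents within the range of
    \<open>exp_le_quadratic\<close>; the second makes the quadratic cost per summand at most
    \<open>c\<close>, half of the linear gain \<open>s * \<epsilon> / (2 * real L)\<close>.\<close>
  define s where "s = min (1 / D) (\<epsilon> / (4 * real L * D\<^sup>2))"
  define c where "c = s * \<epsilon> / (4 * real L)"
  \<comment> \<open>From this index on, the at most \<open>2 * L\<close> discarded summands account
    for no more than half of the deviation \<open>\<epsilon> * real n\<close>.\<close>
  define n0 where "n0 = max L (nat \<lceil>4 * real L * D / \<epsilon>\<rceil>)"
  have D: "0 < D" "2 * B \<le> D" by (auto simp: D_def)
  have s: "0 < s" using D L \<epsilon> by (simp add: s_def)
  have B: "0 \<le> B" using Y(3) abs_ge_zero order_trans by blast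
  have c: "0 < c" using s L \<epsilon> by (simp add: c_def)
  have sD: "s * D \<le> 1"
  proof -
    have "s * D \<le> 1 / D * D" using D by (intro mult_right_mono) (auto simp: s_def)
    then show ?thesis using D by simp
  qed
  have sD2: "(s * D)\<^sup>2 \<le> c"
  proof -
    have "s * D\<^sup>2 \<le> \<epsilon> / (4 * real L * D\<^sup>2) * D\<^sup>2" by (intro mult_right_mono) (auto simp: s_def)
    also have "\<dots> = \<epsilon> / (4 * real L)" using D by simp
    finally have "s * (s * D\<^sup>2) \<le> s * (\<epsilon> / (4 * real L))" using s by (intro mult_left_mono) auto
    then show ?thesis by (simp add: c_def power2_eq_square mult_ac)
  qed
  show ?thesis
  proof (rule that[OF c, of n0])
    fix n m assume n: "n0 \<le> n" and m: "n \<le> m"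
    define p where "p = n div L - 1"
    \<comment> \<open>The remaining half of the deviation, shared equally among the \<open>L\<close>
      residue classes.\<close>
    define a where "a = real n * \<epsilon> / (2 * real L)"
    define T where "T r \<omega> Z = (\<Sum>k<p. moved (r + k * L) Y \<omega> Z - \<mu>)" for r \<omega> Z
    have nL: "L \<le> n" using n by (simp add: n0_def)
    have big: "2 * real L * D \<le> real n * \<epsilon> / 2"
    proof -
      have "4 * real L * D / \<epsilon> \<le> real n" using n by (simp add: n0_def nat_le_iff ceiling_le_iff)
      then show ?thesis using \<epsilon> by (simp add: field_simps)
    qed
    have regT: "regular (T r)" for r
      unfolding T_def diff_conv_add_uminus
      by (intro regular_sum regular_add regular_moved regular_steps Y)
    let ?bad = "\<lambda>\<omega> Z. if \<epsilon> * real n < \<bar>(\<Sum>i<n. moved i Y \<omega> Z) - real n * \<mu>\<bar> then 1 else 0 :: real"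
    let ?E = "\<lambda>r t \<omega> Z. exp (- (s * a)) * exp (t * T r \<omega> Z)"
    have regE: "regular (?E r t)" for r t
      by (intro regular_mult regular_exp regular_steps regT)
    have meas: "(\<lambda>\<omega>. moved i Y \<omega> Z) \<in> borel_measurable (env_law \<alpha>)" for i Z
      by (rule regularD(1)[OF regular_moved[OF Y(2)]])
    have regbad: "regular ?bad"
      by (rule regular_indicator) (use meas in measurable)
    \<comment> \<open>The union bound and Markov's inequality in pointwise form: on the bad event
      some class sum exceeds \<open>a\<close> in absolute value, and its sign decides which of the
      two exponentials is at least 1.\<close>
    have point: "?bad \<omega> Z \<le> (\<Sum>r<L. ?E r s \<omega> Z + ?E r (- s) \<omega> Z)" for \<omega> Z
    proof (cases "\<epsilon> * real n < \<bar>(\<Sum>i<n. moved i Y \<omega> Z) - real n * \<mu>\<bar>")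
      case True
      have "\<bar>moved i Y \<omega> Z - \<mu>\<bar> \<le> D" for i
        using Y(3)[of "shift (int i) (Xpos Z i) \<omega>" "\<lambda>j. Z (i + j)"]
          tiltI_abs_le[OF Y(2,3), of \<theta> L] D(2) unfolding \<mu>_def moved_def by linarith
      then have "\<bar>\<Sum>i<n. moved i Y \<omega> Z - \<mu>\<bar> \<le> (\<Sum>r<L. \<bar>T r \<omega> Z\<bar>) + 2 * real L * D"
        unfolding T_def p_def by (rule block_sum_bound[OF L nL])
      then have gt: "real n * \<epsilon> / 2 < (\<Sum>r<L. \<bar>T r \<omega> Z\<bar>)"
        using True big by (simp add: sum_subtractf mult.commute)
      have "\<exists>r<L. a < \<bar>T r \<omega> Z\<bar>"
      proof (rule ccontr)
        assume "\<not> ?thesis"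
        then have "\<bar>T r \<omega> Z\<bar> \<le> a" if "r < L" for r using that by (meson not_le)
        then have "(\<Sum>r<L. \<bar>T r \<omega> Z\<bar>) \<le> (\<Sum>r<L. a)" by (intro sum_mono) auto
        also have "\<dots> = real n * \<epsilon> / 2" using L by (simp add: a_def)
        finally show False using gt by simp
      qed
      then obtain r where r: "r < L" "a < \<bar>T r \<omega> Z\<bar>" by blast
      have "1 \<le> ?E r s \<omega> Z + ?E r (- s) \<omega> Z"
      proof (cases "0 \<le> T r \<omega> Z")
        case True
        then have "s * a \<le> s * T r \<omega> Z" using r s by (intro mult_left_mono) auto
        then have "1 \<le> ?E r s \<omega> Z" by (simp flip: exp_add)
        then show ?thesis by (simp add: add_increasing2)
      next
        case False
        then have "s * a \<le> s * (- T r \<omega> Z)" using r s by (intro mult_left_mono) auto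
        then have "1 \<le> ?E r (- s) \<omega> Z" by (simp flip: exp_add)
        then show ?thesis by (simp add: add_increasing)
      qed
      also have "\<dots> \<le> (\<Sum>r<L. ?E r s \<omega> Z + ?E r (- s) \<omega> Z)"
        by (rule member_le_sum) (use r in \<open>auto intro!: add_nonneg_nonneg\<close>)
      finally show ?thesis using True by simp
    qed (auto intro!: sum_nonneg add_nonneg_nonneg)
    have E: "tiltI \<theta> m (?E r t) \<le> exp (- c * real n)" if r: "r < L" and t: "\<bar>t\<bar> = s" for r t
    proof -
      have p1: "Suc p * L \<le> n"
      proof -
        have "1 \<le> n div L" using L nL by (simp add: div_greater_zero_iff Suc_leI)
        then have "Suc p = n div L" by (simp add: p_def)
        then show ?thesis by simp
      qed
      have p2: "p \<le> n" using p1 L by (cases L) auto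
      have "\<bar>t\<bar> * (2 * B) \<le> s * D" unfolding t using D s by (intro mult_left_mono) auto
      then have tB: "\<bar>t\<bar> * (2 * B) \<le> 1" using sD by linarith
      have "tiltI \<theta> m (\<lambda>\<omega> Z. exp (t * T r \<omega> Z)) \<le> exp (real p * (t * (2 * B))\<^sup>2)"
        unfolding T_def \<mu>_def using p1 r m by (intro mgf_block_bound[OF Y tB]) auto
      also have "real p * (t * (2 * B))\<^sup>2 \<le> real n * c"
      proof (intro mult_mono)
        have "\<bar>t * (2 * B)\<bar> \<le> \<bar>s * D\<bar>"
          using \<open>\<bar>t\<bar> * (2 * B) \<le> s * D\<close> B s D by (simp add: abs_mult)
        then have "(t * (2 * B))\<^sup>2 \<le> (s * D)\<^sup>2" by (simp only: abs_le_square_iff)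
        then show "(t * (2 * B))\<^sup>2 \<le> c" using sD2 by linarith
      qed (use p2 in auto)
      finally have "tiltI \<theta> m (\<lambda>\<omega> Z. exp (t * T r \<omega> Z)) \<le> exp (real n * c)" by simp
      then have "tiltI \<theta> m (?E r t) \<le> exp (- (s * a)) * exp (real n * c)"
        by (simp add: tiltI_cmult)
      \<comment> \<open>Here \<open>s * a\<close> equals \<open>2 * c * real n\<close>, and half of
        it pays for the moment generating function.\<close>
      also have "\<dots> = exp (- c * real n)"
        using L by (simp add: a_def c_def field_simps flip: exp_add)
      finally show ?thesis .
    qed
    have "tiltI \<theta> m ?bad \<le> tiltI \<theta> m (\<lambda>\<omega> Z. \<Sum>r<L. ?E r s \<omega> Z + ?E r (- s) \<omega> Z)"
      by (rule tiltI_mono[OF regbad _ point]) (intro regular_sum regular_add regE)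
    also have "\<dots> = (\<Sum>r<L. tiltI \<theta> m (?E r s) + tiltI \<theta> m (?E r (- s)))"
      by (subst tiltI_sum) (intro regular_add regE, intro sum.cong refl tiltI_add regE)
    also have "\<dots> \<le> (\<Sum>r<L. exp (- c * real n) + exp (- c * real n))"
      using s by (intro sum_mono add_mono E) auto
    also have "\<dots> = 2 * real L * exp (- c * real n)" by simp
    finally show "tiltI \<theta> m (\<lambda>\<omega> Z. if \<epsilon> * real n < \<bar>(\<Sum>i<n. moved i Y \<omega> Z) - real n * tiltI \<theta> L Y\<bar> then 1 else 0)
      \<le> 2 * real L * exp (- c * real n)"
      unfolding \<mu>_def .
  qed
qed

end

section \<open>The tilting parameter\<close>

text \<open>A point with l1 norm at least 1 is pushed out of the unit ball by an arbitrarily small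
  radial stretch.\<close>

lemma interior_l1_ball:
  fixes \<xi> :: "real^'d::finite"
  assumes "\<xi> \<in> interior {\<eta>. (\<Sum>i\<in>UNIV. \<bar>\<eta>$i\<bar>) \<le> 1}"
  shows "(\<Sum>i\<in>UNIV. \<bar>\<xi>$i\<bar>) < 1"
proof (rule ccontr)
  assume "\<not> ?thesis"
  then have ge: "1 \<le> (\<Sum>i\<in>UNIV. \<bar>\<xi>$i\<bar>)" by simp
  then have "\<xi> \<noteq> 0" by auto
  obtain e where e: "0 < e" "ball \<xi> e \<subseteq> {\<eta>. (\<Sum>i\<in>UNIV. \<bar>\<eta>$i\<bar>) \<le> 1}"
    using assms by (meson mem_interior)
  \<comment> \<open>Stretching by \<open>1 + t\<close> moves the point by exactly
    \<open>e / 2\<close>.\<close>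
  define t where "t = e / (2 * norm \<xi>)"
  have t: "0 < t" using e \<open>\<xi> \<noteq> 0\<close> by (simp add: t_def)
  have "(1 + t) *\<^sub>R \<xi> \<in> ball \<xi> e"
    using e t \<open>\<xi> \<noteq> 0\<close> by (simp add: dist_norm algebra_simps) (simp add: t_def)
  then have "(\<Sum>i\<in>UNIV. \<bar>((1 + t) *\<^sub>R \<xi>)$i\<bar>) \<le> 1" using e by blast
  have "(1 + t) * 1 \<le> (1 + t) * (\<Sum>i\<in>UNIV. \<bar>\<xi>$i\<bar>)"
    using t ge by (intro mult_left_mono) auto
  also have "\<dots> = (\<Sum>i\<in>UNIV. \<bar>((1 + t) *\<^sub>R \<xi>)$i\<bar>)"
    using t by (simp add: abs_mult sum_distrib_left)
  also have "\<dots> \<le> 1" by fact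
  finally show False using t by simp
qed

lemma inner_rvec_axis: "\<theta> \<bullet> rvec (axis i s) = real_of_int s * \<theta> $ i"
proof -
  have "rvec (axis i s) = axis i (real_of_int s)" by (simp add: rvec_def axis_def vec_eq_iff)
  then show ?thesis by (simp add: inner_axis mult.commute)
qed

text \<open>With \<open>x\<close> and \<open>y\<close> the log-densities of two tilted step laws,
  this product is the summand of their symmetrised relative entropy.\<close>

lemma exp_diff_sgn:
  fixes x y :: real
  shows "0 \<le> (exp x - exp y) * (x - y)" "(exp x - exp y) * (x - y) = 0 \<longleftrightarrow> x = y"
  by (cases x y rule: linorder_cases; auto simp: mult_nonneg_nonneg mult_nonpos_nonpos)+

context elliptic_rwre
begin

lemma Lambda_c_has_derivative:
  "(Lambda_c \<alpha> has_derivative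
    (\<lambda>h. \<Sum>z\<in>U. qmean \<alpha> z * exp (\<theta> \<bullet> rvec z - Lambda_c \<alpha> \<theta>) * (h \<bullet> rvec z))) (at \<theta>)"
proof -
  let ?S = "\<lambda>\<theta>. \<Sum>z\<in>U. qmean \<alpha> z * exp (\<theta> \<bullet> rvec z)"
  have S: "(?S has_derivative (\<lambda>h. \<Sum>z\<in>U. qmean \<alpha> z * (exp (\<theta> \<bullet> rvec z) * (h \<bullet> rvec z)))) (at \<theta>)"
    by (auto intro!: derivative_eq_intros simp: mult_ac)
  have "((\<lambda>\<theta>. ln (?S \<theta>)) has_derivative
      (\<lambda>h. (\<Sum>z\<in>U. qmean \<alpha> z * (exp (\<theta> \<bullet> rvec z) * (h \<bullet> rvec z))) * inverse (?S \<theta>))) (at \<theta>)"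
    by (rule DERIV_compose_FDERIV[OF DERIV_ln[OF mgf_pos] S])
  moreover have "(\<Sum>z\<in>U. qmean \<alpha> z * (exp (\<theta> \<bullet> rvec z) * (h \<bullet> rvec z))) * inverse (?S \<theta>)
      = (\<Sum>z\<in>U. qmean \<alpha> z * exp (\<theta> \<bullet> rvec z - Lambda_c \<alpha> \<theta>) * (h \<bullet> rvec z))" for h
    unfolding exp_diff exp_Lambda_c by (subst sum_distrib_right) (simp add: divide_inverse mult_ac)
  ultimately show ?thesis by (simp add: Lambda_c_def[abs_def])
qed

text \<open>Among the exponential terms it suffices to keep the unit step along axis
  \<open>i\<close> pointing to the sign of \<open>\<theta> $ i\<close>; ellipticity bounds its
  weight from below by \<open>c1\<close>.\<close>

lemma Lambda_c_ge: "ln c1 + \<bar>\<theta> $ i\<bar> \<le> Lambda_c \<alpha> \<theta>"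
proof -
  define z :: "int^'d" where "z = axis i (if 0 \<le> \<theta> $ i then 1 else -1)"
  have z: "z \<in> U" by (simp add: z_def axis_in_U)
  have "c1 * exp \<bar>\<theta> $ i\<bar> \<le> qmean \<alpha> z * exp (\<theta> \<bullet> rvec z)"
  proof -
    have "\<theta> \<bullet> rvec z = \<bar>\<theta> $ i\<bar>" by (simp add: z_def inner_rvec_axis)
    then show ?thesis using qmean_ge[OF z] by (simp add: mult_right_mono)
  qed
  also have "\<dots> \<le> (\<Sum>z\<in>U. qmean \<alpha> z * exp (\<theta> \<bullet> rvec z))"
    by (rule member_le_sum) (use z finite_U qmean_pos in \<open>auto intro: less_imp_le\<close>)
  finally have "ln (c1 * exp \<bar>\<theta> $ i\<bar>) \<le> Lambda_c \<alpha> \<theta>"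
    unfolding Lambda_c_def using c1_pos by (subst ln_le_cancel_iff) (auto simp: mgf_pos)
  then show ?thesis using c1_pos by (simp add: ln_mult)
qed

text \<open>For the coordinate \<open>k\<close> of largest modulus, \<open>Lambda_c\<close> grows at
  least like \<open>\<bar>\<theta> $ k\<bar>\<close>, while the linear term grows at most like that
  quantity times the l1 norm of \<open>\<xi>\<close>. The division by the dimension compares
  \<open>norm \<theta>\<close> with the largest coordinate.\<close>

lemma Lambda_c_minus_linear_coercive:
  fixes \<xi> :: "real^'d"
  assumes "(\<Sum>i\<in>UNIV. \<bar>\<xi>$i\<bar>) \<le> 1"
  shows "ln c1 + (1 - (\<Sum>i\<in>UNIV. \<bar>\<xi>$i\<bar>)) * (norm \<theta> / real CARD('d)) \<le> Lambda_c \<alpha> \<theta> - \<xi> \<bullet> \<theta>"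
proof -
  define \<rho> where "\<rho> = (\<Sum>i\<in>UNIV. \<bar>\<xi>$i\<bar>)"
  have "Max (range (\<lambda>i. \<bar>\<theta> $ i\<bar>)) \<in> range (\<lambda>i. \<bar>\<theta> $ i\<bar>)" by (rule Max_in) auto
  then obtain k where "Max (range (\<lambda>i. \<bar>\<theta> $ i\<bar>)) = \<bar>\<theta> $ k\<bar>" by (elim rangeE)
  then have k: "\<bar>\<theta> $ i\<bar> \<le> \<bar>\<theta> $ k\<bar>" for i by (metis Max_ge finite finite_imageI rangeI)
  have "\<xi> \<bullet> \<theta> \<le> (\<Sum>i\<in>UNIV. \<bar>\<xi>$i\<bar> * \<bar>\<theta> $ k\<bar>)"
    unfolding inner_vec_def
  proof (rule sum_mono)
    fix i
    have "\<xi> $ i * \<theta> $ i \<le> \<bar>\<xi> $ i\<bar> * \<bar>\<theta> $ i\<bar>" by (metis abs_ge_self abs_mult)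
    also have "\<dots> \<le> \<bar>\<xi>$i\<bar> * \<bar>\<theta> $ k\<bar>" using k by (intro mult_left_mono) auto
    finally show "\<xi> $ i \<bullet> \<theta> $ i \<le> \<bar>\<xi>$i\<bar> * \<bar>\<theta> $ k\<bar>" by simp
  qed
  then have 1: "\<xi> \<bullet> \<theta> \<le> \<rho> * \<bar>\<theta> $ k\<bar>" by (simp add: \<rho>_def sum_distrib_right)
  have "norm \<theta> \<le> (\<Sum>i\<in>UNIV. \<bar>\<theta> $ i\<bar>)" by (rule norm_le_l1_cart)
  also have "\<dots> \<le> (\<Sum>i\<in>(UNIV::'d set). \<bar>\<theta> $ k\<bar>)" by (rule sum_mono) (rule k)
  finally have "norm \<theta> / real CARD('d) \<le> \<bar>\<theta> $ k\<bar>" by (simp add: divide_le_eq mult.commute)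
  then have "(1 - \<rho>) * (norm \<theta> / real CARD('d)) \<le> (1 - \<rho>) * \<bar>\<theta> $ k\<bar>"
    using assms by (intro mult_left_mono) (auto simp: \<rho>_def)
  then show ?thesis using 1 Lambda_c_ge[of \<theta> k] unfolding \<rho>_def[symmetric] by (simp add: algebra_simps)
qed

text \<open>The parameter is found as a global minimiser of \<open>Lambda_c\<close> minus the linear
  function given by \<open>\<xi>\<close>: coercivity provides the minimiser, and the derivative
  vanishes there.\<close>

lemma ex_tilting_parameter:
  fixes \<xi> :: "real^'d"
  assumes \<xi>: "(\<Sum>i\<in>UNIV. \<bar>\<xi>$i\<bar>) < 1"
  shows "\<exists>\<theta>. (Lambda_c \<alpha> has_derivative (\<lambda>h. \<xi> \<bullet> h)) (at \<theta>)"
proof -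
  define \<kappa> where "\<kappa> = (1 - (\<Sum>i\<in>UNIV. \<bar>\<xi>$i\<bar>)) / real CARD('d)"
  have \<kappa>: "0 < \<kappa>" using \<xi> by (simp add: \<kappa>_def)
  define h where "h \<theta> = Lambda_c \<alpha> \<theta> - \<xi> \<bullet> \<theta>" for \<theta>
  have h_ge: "ln c1 + \<kappa> * norm \<theta> \<le> h \<theta>" for \<theta>
    using Lambda_c_minus_linear_coercive[of \<xi> \<theta>] \<xi> by (simp add: h_def \<kappa>_def)
  \<comment> \<open>Beyond this radius the coercive lower bound already exceeds \<open>h 0\<close>,
    so a minimum over the ball is a global one.\<close>
  define R where "R = (h 0 - ln c1) / \<kappa>"
  have "ln c1 \<le> h 0" using h_ge[of 0] by simp
  then have R: "0 \<le> R" using \<kappa> by (simp add: R_def)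
  have dh: "(h has_derivative (\<lambda>v. (\<Sum>z\<in>U. qmean \<alpha> z * exp (\<theta> \<bullet> rvec z - Lambda_c \<alpha> \<theta>) * (v \<bullet> rvec z)) - \<xi> \<bullet> v)) (at \<theta>)" for \<theta>
    unfolding h_def by (auto intro!: derivative_eq_intros Lambda_c_has_derivative)
  then have "continuous_on (cball 0 R) h"
    by (auto intro!: continuous_at_imp_continuous_on has_derivative_continuous)
  moreover have "cball (0::real^'d) R \<noteq> {}" using R by simp
  ultimately obtain \<theta> where \<theta>: "\<theta> \<in> cball 0 R" "\<forall>y\<in>cball 0 R. h \<theta> \<le> h y"
    using continuous_attains_inf[of "cball 0 R" h] by auto
  have "h \<theta> \<le> h y" for y
  proof (cases "norm y \<le> R")
    case False
    then have "h 0 - ln c1 < \<kappa> * norm y" using \<kappa> by (simp add: R_def not_le divide_less_eq mult.commute)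
    then have "h 0 \<le> h y" using h_ge[of y] by simp
    moreover have "h \<theta> \<le> h 0" using \<theta> R by simp
    ultimately show ?thesis by simp
  qed (use \<theta> in simp)
  then have "(\<lambda>v. (\<Sum>z\<in>U. qmean \<alpha> z * exp (\<theta> \<bullet> rvec z - Lambda_c \<alpha> \<theta>) * (v \<bullet> rvec z)) - \<xi> \<bullet> v) = (\<lambda>v. 0)"
    by (intro differential_zero_maxmin[OF _ open_UNIV dh]) auto
  then have "(\<lambda>v. \<Sum>z\<in>U. qmean \<alpha> z * exp (\<theta> \<bullet> rvec z - Lambda_c \<alpha> \<theta>) * (v \<bullet> rvec z)) = (\<lambda>v. \<xi> \<bullet> v)"
    by (simp add: fun_eq_iff)
  then show ?thesis using Lambda_c_has_derivative[of \<theta>] by auto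
qed

lemma tilted_mean:
  assumes "(Lambda_c \<alpha> has_derivative (\<lambda>h. \<xi> \<bullet> h)) (at \<theta>)"
  shows "(\<Sum>z\<in>U. qmean \<alpha> z * exp (\<theta> \<bullet> rvec z - Lambda_c \<alpha> \<theta>) * (h \<bullet> rvec z)) = \<xi> \<bullet> h"
  using has_derivative_unique[OF Lambda_c_has_derivative assms] by (simp add: fun_eq_iff)

text \<open>If two tilted laws have the same mean, their symmetrised relative entropy vanishes.\<close>

lemma tilting_parameter_unique:
  assumes 1: "(Lambda_c \<alpha> has_derivative (\<lambda>h. \<xi> \<bullet> h)) (at \<theta>\<^sub>1)"
    and 2: "(Lambda_c \<alpha> has_derivative (\<lambda>h. \<xi> \<bullet> h)) (at \<theta>\<^sub>2)"
  shows "\<theta>\<^sub>1 = \<theta>\<^sub>2"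
proof -
  define l where "l \<theta> z = \<theta> \<bullet> rvec z - Lambda_c \<alpha> \<theta>" for \<theta> and z :: "int^'d"
  define d where "d = Lambda_c \<alpha> \<theta>\<^sub>1 - Lambda_c \<alpha> \<theta>\<^sub>2"
  have l_diff: "l \<theta>\<^sub>1 z - l \<theta>\<^sub>2 z = (\<theta>\<^sub>1 - \<theta>\<^sub>2) \<bullet> rvec z - d" for z
    by (simp add: l_def d_def inner_diff_left)
  have mean: "(\<Sum>z\<in>U. qmean \<alpha> z * exp (l \<theta> z) * ((\<theta>\<^sub>1 - \<theta>\<^sub>2) \<bullet> rvec z - d)) = \<xi> \<bullet> (\<theta>\<^sub>1 - \<theta>\<^sub>2) - d"
    if "(Lambda_c \<alpha> has_derivative (\<lambda>h. \<xi> \<bullet> h)) (at \<theta>)" for \<theta>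
    using tilted_mean[OF that, of "\<theta>\<^sub>1 - \<theta>\<^sub>2"] tilted_mass[of \<theta>]
    by (simp add: right_diff_distrib sum_subtractf l_def flip: sum_distrib_right)
  have "(\<Sum>z\<in>U. qmean \<alpha> z * ((exp (l \<theta>\<^sub>1 z) - exp (l \<theta>\<^sub>2 z)) * (l \<theta>\<^sub>1 z - l \<theta>\<^sub>2 z))) = 0"
    using mean[OF 1] mean[OF 2] unfolding l_diff
    by (simp add: left_diff_distrib right_diff_distrib[of "qmean \<alpha> _"] sum_subtractf mult.assoc)
  then have "\<forall>z\<in>U. qmean \<alpha> z * ((exp (l \<theta>\<^sub>1 z) - exp (l \<theta>\<^sub>2 z)) * (l \<theta>\<^sub>1 z - l \<theta>\<^sub>2 z)) = 0"
    by (subst (asm) sum_nonneg_eq_0_iff)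
      (auto simp: finite_U intro!: mult_nonneg_nonneg[OF _ exp_diff_sgn(1)] less_imp_le[OF qmean_pos])
  then have "l \<theta>\<^sub>1 z = l \<theta>\<^sub>2 z" if "z \<in> U" for z
    using that qmean_pos[of z] exp_diff_sgn(2)[of "l \<theta>\<^sub>1 z" "l \<theta>\<^sub>2 z"]
    by (metis less_numeral_extra(3) mult_eq_0_iff)
  then have "(\<theta>\<^sub>1 - \<theta>\<^sub>2) \<bullet> rvec z = d" if "z \<in> U" for z
    using l_diff[of z] that by simp
  \<comment> \<open>Opposite unit steps force a coordinate and its negative to share the value
    \<open>d\<close>, so the coordinate vanishes.\<close>
  from this[OF axis_in_U(1)] this[OF axis_in_U(2)]
  have "(\<theta>\<^sub>1 - \<theta>\<^sub>2) $ i = d" "- (\<theta>\<^sub>1 - \<theta>\<^sub>2) $ i = d" for i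
    by (simp_all only: inner_rvec_axis) simp_all
  then have "(\<theta>\<^sub>1 - \<theta>\<^sub>2) $ i = 0" for i by (metis equal_neg_zero vector_uminus_component)
  then show ?thesis by (simp add: vec_eq_iff)
qed

lemma theta_of_has_derivative:
  assumes "(\<Sum>i\<in>UNIV. \<bar>\<xi>$i\<bar>) < 1"
  shows "(Lambda_c \<alpha> has_derivative (\<lambda>h. \<xi> \<bullet> h)) (at (theta_of \<alpha> \<xi>))"
  unfolding theta_of_def
  by (rule theI') (use ex_tilting_parameter[OF assms] tilting_parameter_unique in blast)

end

section \<open>Local functionals\<close>

text \<open>Insensitivity to the levels below \<open>n\<close> holds for the generators and survives
  complements in \<open>Omega\<close> and countable unions.\<close>

lemma Bplus_cong:
  assumes "A \<in> Bplus n" "\<omega> \<in> Omega" "\<omega>' \<in> Omega"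
    and "\<And>m x. n \<le> m \<Longrightarrow> \<omega> (m, x) = \<omega>' (m, x)"
  shows "\<omega> \<in> A \<longleftrightarrow> \<omega>' \<in> A"
  using assms(1) unfolding Bplus_def
  by (induction rule: sigma_sets.induct) (use assms in auto)

lemma Bminus_cong:
  assumes "A \<in> Bminus n" "\<omega> \<in> Omega" "\<omega>' \<in> Omega"
    and "\<And>m x. m \<le> n \<Longrightarrow> \<omega> (m, x) = \<omega>' (m, x)"
  shows "\<omega> \<in> A \<longleftrightarrow> \<omega>' \<in> A"
  using assms(1) unfolding Bminus_def
  by (induction rule: sigma_sets.induct) (use assms in auto)

lemma Bplus_subset: "Bplus n \<subseteq> Pow Omega"
  unfolding Bplus_def by (rule subsetI, rule PowI, erule sigma_sets_into_sp[rotated], auto)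

text \<open>An intersection of two sigma-algebras is again one, so generating from it adds no
  sets.\<close>

lemma sets_Bplus_Bminus:
  "sets (sigma Omega (Bplus n \<inter> Bminus m)) \<subseteq> Bplus n \<inter> Bminus m"
proof -
  have sub: "Bplus n \<inter> Bminus m \<subseteq> Pow Omega" using Bplus_subset by blast
  have alg: "sigma_algebra Omega (Bplus n)" "sigma_algebra Omega (Bminus m)"
    unfolding Bplus_def Bminus_def by (rule sigma_algebra_sigma_sets, auto)+
  have "sigma_sets Omega (Bplus n \<inter> Bminus m) \<subseteq> Bplus n"
    "sigma_sets Omega (Bplus n \<inter> Bminus m) \<subseteq> Bminus m"
    by (simp_all add: sigma_algebra.sigma_sets_subset[OF alg(1)] sigma_algebra.sigma_sets_subset[OF alg(2)])
  then show ?thesis unfolding sets_measure_of[OF sub] by blast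
qed

text \<open>Membership in both sigma-algebras does not by itself exhibit a function of the levels
  between \<open>n\<close> and \<open>m\<close>. Locality is obtained by splicing the two
  environments and comparing the splice with each of them, once through \<open>Bplus\<close> and
  once through \<open>Bminus\<close>.\<close>

lemma local_cong:
  fixes g :: "('d::finite) env \<Rightarrow> real"
  assumes g: "g \<in> borel_measurable (sigma Omega (Bplus n \<inter> Bminus m))"
    and \<omega>: "\<omega> \<in> Omega" "\<omega>' \<in> Omega"
    and agree: "\<And>k x. n \<le> k \<Longrightarrow> k \<le> m \<Longrightarrow> \<omega> (k, x) = \<omega>' (k, x)"
  shows "g \<omega> = g \<omega>'"
proof -
  have sp: "space (sigma Omega (Bplus n \<inter> Bminus m)) = Omega"
    by (simp add: space_measure_of_conv)
  \<comment> \<open>The splice agrees with \<open>\<omega>\<close> from level \<open>n\<close>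
    upwards and, since the two environments coincide between \<open>n\<close> and \<open>m\<close>,
    with \<open>\<omega>'\<close> up to level \<open>m\<close>.\<close>
  define \<omega>'' where "\<omega>'' = (\<lambda>(k, x). if n \<le> k then \<omega> (k, x) else \<omega>' (k, x))"
  have \<omega>'': "\<omega>'' \<in> Omega" using \<omega> by (auto simp: Omega_def \<omega>''_def)
  have "g -` {g \<omega>''} \<inter> Omega \<in> Bplus n \<inter> Bminus m"
    using measurable_sets[OF g, of "{g \<omega>''}"] sets_Bplus_Bminus[of n m] by (auto simp: sp)
  then have A: "g -` {g \<omega>''} \<inter> Omega \<in> Bplus n" "g -` {g \<omega>''} \<inter> Omega \<in> Bminus m" by auto
  have "\<omega>'' \<in> g -` {g \<omega>''} \<inter> Omega \<longleftrightarrow> \<omega> \<in> g -` {g \<omega>''} \<inter> Omega"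
    by (rule Bplus_cong[OF A(1) \<omega>'' \<omega>(1)]) (simp add: \<omega>''_def)
  moreover have "\<omega>'' \<in> g -` {g \<omega>''} \<inter> Omega \<longleftrightarrow> \<omega>' \<in> g -` {g \<omega>''} \<inter> Omega"
    by (rule Bminus_cong[OF A(2) \<omega>'' \<omega>(2)]) (simp add: \<omega>''_def agree)
  ultimately show ?thesis using \<omega>'' by simp
qed

text \<open>Sets of the intersection lie in particular in \<open>Bplus n\<close>, whose generators
  pull back along \<open>toOmega\<close> to events about a single site.\<close>

lemma (in rwre) measurable_toOmega_local:
  assumes g: "g \<in> borel_measurable (sigma Omega (Bplus n \<inter> Bminus m))"
  shows "(\<lambda>\<omega>. g (toOmega \<omega>)) \<in> borel_measurable (env_law \<alpha>)"
proof (rule measurable_compose[OF _ g])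
  have sub: "Bplus n \<inter> Bminus m \<subseteq> Pow Omega" using Bplus_subset by blast
  let ?G = "{{\<omega>\<in>Omega. \<omega> (k, x) \<in> A} | k x A. n \<le> k \<and> A \<in> sets locM} :: 'd env set set"
  have "toOmega \<in> env_law \<alpha> \<rightarrow>\<^sub>M sigma Omega ?G"
  proof (rule measurable_measure_of)
    fix y assume "y \<in> ?G"
    then obtain k x A where y: "y = {\<omega>\<in>Omega. \<omega> (k, x) \<in> A}" and A: "A \<in> sets locM" by auto
    have [measurable]: "A \<in> sets \<alpha>" using A sets_\<alpha> by simp
    have "(\<lambda>\<omega>. toOmega \<omega> (k, x)) \<in> env_law \<alpha> \<rightarrow>\<^sub>M \<alpha>" by measurable
    then have "(\<lambda>\<omega>. toOmega \<omega> (k, x)) -` A \<inter> space (env_law \<alpha>) \<in> sets (env_law \<alpha>)"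
      by (rule measurable_sets) fact
    then show "toOmega -` y \<inter> space (env_law \<alpha>) \<in> sets (env_law \<alpha>)"
      by (simp add: y vimage_def toOmega_in_Omega)
  qed (auto simp: toOmega_in_Omega)
  moreover have "sets (sigma Omega ?G) = Bplus n"
    unfolding Bplus_def by (rule sets_measure_of) auto
  ultimately have meas: "toOmega -` A \<in> sets (env_law \<alpha>)" if "A \<in> Bplus n" for A
    using measurable_sets[of toOmega "env_law \<alpha>" "sigma Omega ?G" A] that by (simp add: space_env)
  show "toOmega \<in> env_law \<alpha> \<rightarrow>\<^sub>M sigma Omega (Bplus n \<inter> Bminus m)"
    by (rule measurable_measure_of) (use sub meas in \<open>auto simp: toOmega_in_Omega space_env\<close>)
qed

text \<open>A total version of \<open>f\<close> that ignores values outside \<open>Omega\<close>, outside \<open>U\<close> and beyond step \<open>K\<close>,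
  so that it is bounded, measurable and local without side conditions.\<close>

definition localize :: "nat \<Rightarrow> ('d::finite env \<times> (nat \<Rightarrow> int^'d) \<Rightarrow> real) \<Rightarrow> 'd env \<Rightarrow> (nat \<Rightarrow> int^'d) \<Rightarrow> real"
  where "localize K f \<omega> Z = f (toOmega \<omega>, \<lambda>i. if i < K \<and> Z (i + 1) \<in> U then Z (i + 1) else u0)"

lemma shift_in_Omega: "\<omega> \<in> Omega \<Longrightarrow> shift m y \<omega> \<in> Omega"
  by (auto simp: Omega_def shift_def)

lemma sum_lessThan_add:
  fixes g :: "nat \<Rightarrow> real"
  shows "(\<Sum>i<a + b. g i) = (\<Sum>i<a. g i) + (\<Sum>i<b. g (a + i))"
  by (induction b) auto

lemma norm_rvec_le: "z \<in> U \<Longrightarrow> norm (rvec z) \<le> 1"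
proof -
  assume "z \<in> U"
  then have "real_of_int (\<Sum>i\<in>UNIV. \<bar>z$i\<bar>) = 1" by (simp only: U_def) simp
  then show ?thesis using norm_le_l1_cart[of "rvec z"] by (simp add: rvec_def)
qed

lemma norm_rvec_Xpos_le: "(\<And>i. Z i \<in> U) \<Longrightarrow> norm (rvec (Xpos Z n)) \<le> real n"
proof (induction n)
  case (Suc n)
  have "norm (rvec (Xpos Z n) + rvec (Z (Suc n))) \<le> real n + 1"
    using Suc norm_rvec_le[of "Z (Suc n)"] by (intro norm_triangle_le add_mono) auto
  then show ?case by (simp add: Xpos_Suc rvec_add algebra_simps)
qed (simp add: rvec_0)

lemma rvec_Xpos_nth: "rvec (Xpos Z n) $ i = (\<Sum>j<n. real_of_int (Z (Suc j) $ i))"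
  by (induction n) (simp_all add: rvec_0 Xpos_Suc rvec_add, simp add: rvec_def)

section \<open>The rate bound\<close>

context elliptic_rwre
begin

text \<open>\<open>V\<close> may look back by \<open>N\<close> levels, so only its translate
  \<open>moved N V\<close> is adapted. Over \<open>n\<close> times the sums of the two differ by
  \<open>N\<close> initial and \<open>N\<close> final terms, a bounded error that is absorbed by
  half of \<open>\<epsilon>\<close>.\<close>

lemma tiltI_local_average:
  fixes V :: "'d env \<Rightarrow> (nat \<Rightarrow> int^'d) \<Rightarrow> real"
  assumes V: "regular V" "\<And>\<omega> Z. \<bar>V \<omega> Z\<bar> \<le> B" and ad: "adapted L (moved N V)"
    and L: "0 < L" and \<epsilon>: "0 < \<epsilon>"
  obtains c where "0 < c" and "\<forall>\<^sub>F n in sequentially. \<forall>m\<ge>n.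
    tiltI \<theta> m (\<lambda>\<omega> Z. if \<epsilon> < \<bar>1 / real n * (\<Sum>j<n. moved j V \<omega> Z) - tiltI \<theta> L (moved N V)\<bar> then 1 else 0)
      \<le> 2 * real L * exp (- c * real n)"
proof -
  let ?Y = "moved N V" and ?\<mu> = "tiltI \<theta> L (moved N V)"
  have Yb: "\<bar>?Y \<omega> Z\<bar> \<le> B" for \<omega> Z using V(2) by (simp add: moved_def)
  obtain c n0 where c: "0 < c" and conc: "\<And>n m. n0 \<le> n \<Longrightarrow> n \<le> m \<Longrightarrow>
    tiltI \<theta> m (\<lambda>\<omega> Z. if \<epsilon> / 2 * real n < \<bar>(\<Sum>i<n. moved i ?Y \<omega> Z) - real n * ?\<mu>\<bar> then 1 else 0)
      \<le> 2 * real L * exp (- c * real n)"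
    using tiltI_concentration[OF ad regular_moved[OF V(1)] Yb L, of "\<epsilon> / 2" \<theta>] \<epsilon> by auto
  have meas: "(\<lambda>\<omega>. moved i V \<omega> Z) \<in> borel_measurable (env_law \<alpha>)"
    "(\<lambda>\<omega>. moved i (moved N V) \<omega> Z) \<in> borel_measurable (env_law \<alpha>)" for i Z
    by (intro regularD(1) regular_moved V)+
  \<comment> \<open>Ensures that the boundary error \<open>2 * real N * B\<close> is at most
    \<open>\<epsilon> / 2 * real n\<close>, and that \<open>n\<close> is positive.\<close>
  define n1 where "n1 = max (max 1 n0) (nat \<lceil>4 * real N * B / \<epsilon>\<rceil>)"
  have "tiltI \<theta> m (\<lambda>\<omega> Z. if \<epsilon> < \<bar>1 / real n * (\<Sum>j<n. moved j V \<omega> Z) - ?\<mu>\<bar> then 1 else 0)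
      \<le> 2 * real L * exp (- c * real n)" if n: "n1 \<le> n" and m: "n \<le> m" for n m
  proof -
    have npos: "0 < real n" and n0: "n0 \<le> n" using n by (auto simp: n1_def)
    have big: "2 * real N * B \<le> \<epsilon> / 2 * real n"
    proof -
      have "4 * real N * B / \<epsilon> \<le> real n" using n by (simp add: n1_def nat_le_iff ceiling_le_iff)
      then show ?thesis using \<epsilon> by (simp add: field_simps)
    qed
    have point: "\<epsilon> / 2 * real n < \<bar>(\<Sum>i<n. moved i ?Y \<omega> Z) - real n * ?\<mu>\<bar>"
      if dev: "\<epsilon> < \<bar>1 / real n * (\<Sum>j<n. moved j V \<omega> Z) - ?\<mu>\<bar>" for \<omega> Z
    proof -
      let ?v = "\<lambda>j. moved j V \<omega> Z"
      have vb: "\<bar>?v j\<bar> \<le> B" for j using V(2) by (simp add: moved_def)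
      have "(\<Sum>i<n. moved i ?Y \<omega> Z) = (\<Sum>i<n. ?v (N + i))"
        by (simp add: moved_moved add.commute)
      moreover have "(\<Sum>i<N. ?v i) + (\<Sum>i<n. ?v (N + i)) = (\<Sum>i<n. ?v i) + (\<Sum>i<N. ?v (n + i))"
        using sum_lessThan_add[of ?v N n] sum_lessThan_add[of ?v n N] by (simp add: add.commute)
      moreover have "\<bar>\<Sum>i<N. ?v (k + i)\<bar> \<le> real N * B" for k
        using order_trans[OF sum_abs sum_bounded_above[of "{..<N}" "\<lambda>i. \<bar>?v (k + i)\<bar>" B]] vb by simp
      from this[of 0] this[of n] have "\<bar>\<Sum>i<N. ?v i\<bar> \<le> real N * B" "\<bar>\<Sum>i<N. ?v (n + i)\<bar> \<le> real N * B"
        by simp_all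
      moreover have "\<epsilon> * real n < \<bar>(\<Sum>j<n. ?v j) - real n * ?\<mu>\<bar>"
      proof -
        have "\<epsilon> * real n < \<bar>1 / real n * (\<Sum>j<n. ?v j) - ?\<mu>\<bar> * \<bar>real n\<bar>"
          using dev npos by simp
        also have "\<dots> = \<bar>(1 / real n * (\<Sum>j<n. ?v j) - ?\<mu>) * real n\<bar>" by (rule abs_mult[symmetric])
        also have "(1 / real n * (\<Sum>j<n. ?v j) - ?\<mu>) * real n = (\<Sum>j<n. ?v j) - real n * ?\<mu>"
          using npos by (simp add: algebra_simps)
        finally show ?thesis .
      qed
      ultimately show ?thesis using big by linarith
    qed
    have "tiltI \<theta> m (\<lambda>\<omega> Z. if \<epsilon> < \<bar>1 / real n * (\<Sum>j<n. moved j V \<omega> Z) - ?\<mu>\<bar> then 1 else 0)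
      \<le> tiltI \<theta> m (\<lambda>\<omega> Z. if \<epsilon> / 2 * real n < \<bar>(\<Sum>i<n. moved i ?Y \<omega> Z) - real n * ?\<mu>\<bar> then 1 else 0)"
    proof (rule tiltI_mono)
      show "regular (\<lambda>\<omega> Z. if \<epsilon> < \<bar>1 / real n * (\<Sum>j<n. moved j V \<omega> Z) - ?\<mu>\<bar> then 1 else 0)"
        "regular (\<lambda>\<omega> Z. if \<epsilon> / 2 * real n < \<bar>(\<Sum>i<n. moved i ?Y \<omega> Z) - real n * ?\<mu>\<bar> then 1 else 0)"
        by (rule regular_indicator; use meas in measurable)+
    qed (use point in auto)
    also have "\<dots> \<le> 2 * real L * exp (- c * real n)" by (rule conc[OF n0 m])
    finally show ?thesis .
  qed
  then show ?thesis using c by (intro that[of c]) (auto simp: eventually_sequentially)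
qed

text \<open>A weak law of large numbers, needed because a conditional probability is a quotient: it
  keeps the conditioning event from being small under the tilted law. It is concentration of each
  coordinate of the steps, with windows of length one.\<close>

lemma tiltI_near_mean:
  assumes \<theta>: "(Lambda_c \<alpha> has_derivative (\<lambda>h. \<xi> \<bullet> h)) (at \<theta>)" and \<delta>: "0 < \<delta>"
  shows "\<forall>\<^sub>F n in sequentially. \<forall>m\<ge>n.
    1 / 2 \<le> tiltI \<theta> m (\<lambda>\<omega> Z. if norm (rvec (Xpos Z n) /\<^sub>R real n - \<xi>) \<le> \<delta> then 1 else 0)"
proof -
  let ?d = "real CARD('d)"
  \<comment> \<open>Cutting off steps outside \<open>U\<close> makes the functional bounded by 1 on
    all step sequences; along actual paths nothing changes.\<close>
  define V where "V i (\<omega> :: 'd env) Z = (if Z 1 \<in> U then real_of_int (Z 1 $ i) else 0)"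
    for i :: 'd and \<omega> and Z :: "nat \<Rightarrow> int^'d"
  let ?dev = "\<lambda>n i \<omega> Z. if \<delta> / ?d < \<bar>1 / real n * (\<Sum>j<n. moved j (V i) \<omega> Z) - tiltI \<theta> 1 (moved 0 (V i))\<bar> then 1 else 0 :: real"
  have regV: "regular (V i)" for i unfolding V_def by (rule regular_steps)
  have Vb: "\<bar>V i \<omega> Z\<bar> \<le> 1" for i \<omega> Z
    using component_le_norm_cart[of "rvec (Z 1)" i] norm_rvec_le[of "Z 1"]
    by (auto simp: V_def rvec_def)
  have adV: "adapted 1 (moved 0 (V i))" for i unfolding adapted_def V_def by simp
  have mean: "tiltI \<theta> 1 (moved 0 (V i)) = \<xi> $ i" for i
  proof -
    have "tiltI \<theta> 1 (V i) = (\<Sum>z\<in>U. qmean \<alpha> z * exp (\<theta> \<bullet> rvec z - Lambda_c \<alpha> \<theta>) *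
        (if z \<in> U then real_of_int (z $ i) else 0))"
      unfolding V_def by (rule tiltI_step)
    also have "\<dots> = (\<Sum>z\<in>U. qmean \<alpha> z * exp (\<theta> \<bullet> rvec z - Lambda_c \<alpha> \<theta>) * (axis i 1 \<bullet> rvec z))"
      by (intro sum.cong) (auto simp: inner_axis' rvec_def)
    also have "\<dots> = \<xi> \<bullet> axis i 1" by (rule tilted_mean[OF \<theta>])
    finally show ?thesis by (simp add: inner_axis)
  qed
  have regdev: "regular (?dev n i)" for n i
  proof (rule regular_indicator)
    have [measurable]: "(\<lambda>\<omega>. moved j (V i) \<omega> Z) \<in> borel_measurable (env_law \<alpha>)" for j Z
      by (intro regularD(1) regular_moved regV)
    show "Measurable.pred (env_law \<alpha>) (\<lambda>\<omega>. \<delta> / ?d < \<bar>1 / real n * (\<Sum>j<n. moved j (V i) \<omega> Z) - tiltI \<theta> 1 (moved 0 (V i))\<bar>)" for Z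
      by measurable
  qed
  \<comment> \<open>One share of the failure probability 1/2 per coordinate.\<close>
  have small: "\<forall>\<^sub>F n in sequentially. \<forall>m\<ge>n. tiltI \<theta> m (?dev n i) \<le> 1 / (2 * ?d)" for i
  proof -
    obtain c where c: "0 < c" and ev: "\<forall>\<^sub>F n in sequentially. \<forall>m\<ge>n.
        tiltI \<theta> m (?dev n i) \<le> 2 * real 1 * exp (- c * real n)"
      using tiltI_local_average[OF regV Vb adV[of i], of "\<delta> / ?d" \<theta>] \<delta> by auto
    have "(\<lambda>n. 2 * real 1 * exp (- c * real n)) \<longlonglongrightarrow> 0"
      using c by real_asymp
    then have "\<forall>\<^sub>F n in sequentially. 2 * real 1 * exp (- c * real n) < 1 / (2 * ?d)"
      by (rule order_tendstoD) simp
    with ev show ?thesis by eventually_elim force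
  qed
  then have "\<forall>\<^sub>F n in sequentially. \<forall>i. \<forall>m\<ge>n. tiltI \<theta> m (?dev n i) \<le> 1 / (2 * ?d)"
    by (rule eventually_all_finite)
  then show ?thesis using eventually_gt_at_top[of 0]
  proof eventually_elim
    case (elim n)
    show ?case
    proof (intro allI impI)
      fix m assume m: "n \<le> m"
      let ?near = "\<lambda>(\<omega> :: 'd env) Z. if norm (rvec (Xpos Z n) /\<^sub>R real n - \<xi>) \<le> \<delta> then 1 else 0 :: real"
      have regnear: "regular ?near" by (rule regular_steps)
      have "tiltI \<theta> m (\<lambda>_ _. 1) \<le> tiltI \<theta> m (\<lambda>\<omega> Z. ?near \<omega> Z + (\<Sum>i\<in>UNIV. ?dev n i \<omega> Z))"
      proof (intro tiltI_mono regular_add regnear regular_sum regdev regular_steps)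
        fix \<omega> :: "'d env" and zs :: "(int^'d) list" assume zs: "zs \<in> paths m"
        let ?Z = "stepseq zs"
        show "1 \<le> ?near \<omega> ?Z + (\<Sum>i\<in>UNIV. ?dev n i \<omega> ?Z)"
        proof (cases "\<exists>i. \<delta> / ?d < \<bar>(rvec (Xpos ?Z n) /\<^sub>R real n - \<xi>) $ i\<bar>")
          case True
          then obtain i where i: "\<delta> / ?d < \<bar>(rvec (Xpos ?Z n) /\<^sub>R real n - \<xi>) $ i\<bar>" by blast
          have "(\<Sum>j<n. moved j (V i) \<omega> ?Z) = rvec (Xpos ?Z n) $ i"
            unfolding rvec_Xpos_nth by (simp add: moved_def V_def stepseq_in_U[OF zs])
          then have "?dev n i \<omega> ?Z = 1"
            using i by (simp add: mean[simplified] divide_inverse mult.commute)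
          moreover have "?dev n i \<omega> ?Z \<le> (\<Sum>i\<in>UNIV. ?dev n i \<omega> ?Z)"
            by (rule member_le_sum[where f = "\<lambda>i. ?dev n i \<omega> ?Z"]) auto
          ultimately show ?thesis by (auto intro: add_increasing)
        next
          case False
          have "norm (rvec (Xpos ?Z n) /\<^sub>R real n - \<xi>) \<le> (\<Sum>i\<in>UNIV. \<bar>(rvec (Xpos ?Z n) /\<^sub>R real n - \<xi>) $ i\<bar>)"
            by (rule norm_le_l1_cart)
          also have "\<dots> \<le> (\<Sum>i\<in>(UNIV::'d set). \<delta> / ?d)"
            using False by (intro sum_mono) (simp add: not_less)
          also have "\<dots> = \<delta>" by simp
          finally have "?near \<omega> ?Z = 1" by simp
          moreover have "0 \<le> (\<Sum>i\<in>UNIV. ?dev n i \<omega> ?Z)" by (intro sum_nonneg) auto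
          ultimately show ?thesis by linarith
        qed
      qed
      also have "\<dots> = tiltI \<theta> m ?near + (\<Sum>i\<in>UNIV. tiltI \<theta> m (?dev n i))"
        by (subst tiltI_add[OF regnear regular_sum[OF regdev]]) (subst tiltI_sum[OF regdev], simp)
      also have "(\<Sum>i\<in>UNIV. tiltI \<theta> m (?dev n i)) \<le> (\<Sum>i\<in>(UNIV::'d set). 1 / (2 * ?d))"
        using elim m by (intro sum_mono) auto
      also have "\<dots> = 1 / 2" by simp
      finally show "1 / 2 \<le> tiltI \<theta> m ?near" by (simp add: tiltI_1)
    qed
  qed
qed

text \<open>The density belongs to time \<open>n + K\<close>, the conditioning to time
  \<open>n\<close>. The \<open>K\<close> extra steps have norm at most 1 each and the position at
  time \<open>n\<close> is within \<open>real n * \<delta>\<close> of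
  \<open>real n *\<^sub>R \<xi>\<close>; Cauchy-Schwarz turns this into the error \<open>e\<close>
  in the exponent.\<close>

lemma tilt_near_bounds:
  fixes \<theta> \<xi> :: "real^'d" and K :: nat
  assumes Z: "\<And>i. Z i \<in> U" and n: "0 < n" and near: "norm (rvec (Xpos Z n) /\<^sub>R real n - \<xi>) \<le> \<delta>"
  defines "s \<equiv> real n * (\<theta> \<bullet> \<xi>) - real (n + K) * Lambda_c \<alpha> \<theta>"
    and "e \<equiv> norm \<theta> * (real K + real n * \<delta>)"
  shows "exp (s - e) \<le> tilt \<theta> (n + K) Z" "tilt \<theta> (n + K) Z \<le> exp (s + e)"
proof -
  have "rvec (Xpos Z n) - real n *\<^sub>R \<xi> = real n *\<^sub>R (rvec (Xpos Z n) /\<^sub>R real n - \<xi>)"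
    using n by (simp add: algebra_simps)
  then have 1: "norm (rvec (Xpos Z n) - real n *\<^sub>R \<xi>) \<le> real n * \<delta>"
    using near by (simp add: mult_left_mono)
  have 2: "norm (rvec (Xpos (\<lambda>i. Z (n + i)) K)) \<le> real K" by (rule norm_rvec_Xpos_le) (rule Z)
  have eq: "rvec (Xpos Z (n + K)) - real n *\<^sub>R \<xi>
      = rvec (Xpos (\<lambda>i. Z (n + i)) K) + (rvec (Xpos Z n) - real n *\<^sub>R \<xi>)"
    by (simp add: Xpos_add[of Z n K] rvec_add)
  have "norm (rvec (Xpos Z (n + K)) - real n *\<^sub>R \<xi>) \<le> real K + real n * \<delta>"
    unfolding eq using norm_triangle_ineq[of "rvec (Xpos (\<lambda>i. Z (n + i)) K)" "rvec (Xpos Z n) - real n *\<^sub>R \<xi>"] 1 2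
    by linarith
  then have "norm \<theta> * norm (rvec (Xpos Z (n + K)) - real n *\<^sub>R \<xi>) \<le> e"
    unfolding e_def by (intro mult_left_mono) auto
  then have "\<bar>\<theta> \<bullet> (rvec (Xpos Z (n + K)) - real n *\<^sub>R \<xi>)\<bar> \<le> e"
    using Cauchy_Schwarz_ineq2 order_trans by blast
  then have "\<bar>\<theta> \<bullet> rvec (Xpos Z (n + K)) - real n * (\<theta> \<bullet> \<xi>)\<bar> \<le> e" by (simp add: inner_diff_right)
  then show "exp (s - e) \<le> tilt \<theta> (n + K) Z" "tilt \<theta> (n + K) Z \<le> exp (s + e)"
    unfolding tilt_def s_def by auto
qed

text \<open>Returning from the tilted to the annealed law, the common exponent \<open>s\<close>
  cancels in the quotient, while the error \<open>e\<close> is paid once in the numerator and once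
  in the denominator. The factor 2 is the inverse of the lower bound 1/2.\<close>

lemma annI_ratio_le:
  fixes P :: "'d env \<Rightarrow> (nat \<Rightarrow> int^'d) \<Rightarrow> bool"
  assumes P: "\<And>Z. Measurable.pred (env_law \<alpha>) (\<lambda>\<omega>. P \<omega> Z)" and n: "0 < n"
    and bad: "tiltI \<theta> (n + K) (\<lambda>\<omega> Z. if P \<omega> Z then 1 else 0) \<le> b"
    and good: "1 / 2 \<le> tiltI \<theta> (n + K)
      (\<lambda>\<omega> Z. if norm (rvec (Xpos Z n) /\<^sub>R real n - \<xi>) \<le> \<delta> then 1 else 0)"
  shows "annI (n + K) (\<lambda>\<omega> Z. if P \<omega> Z \<and> norm (rvec (Xpos Z n) /\<^sub>R real n - \<xi>) \<le> \<delta> then 1 else 0)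
      / annI (n + K) (\<lambda>\<omega> Z. if norm (rvec (Xpos Z n) /\<^sub>R real n - \<xi>) \<le> \<delta> then 1 else 0)
    \<le> 2 * b * exp (2 * norm \<theta> * (real K + real n * \<delta>))"
proof -
  define s where "s = real n * (\<theta> \<bullet> \<xi>) - real (n + K) * Lambda_c \<alpha> \<theta>"
  define e where "e = norm \<theta> * (real K + real n * \<delta>)"
  let ?near = "\<lambda>Z. norm (rvec (Xpos Z n) /\<^sub>R real n - \<xi>) \<le> \<delta>"
  let ?F = "\<lambda>\<omega> Z. if P \<omega> Z \<and> ?near Z then 1 else 0 :: real"
  let ?P = "\<lambda>\<omega> Z. if P \<omega> Z then 1 else 0 :: real"
  let ?G = "\<lambda>(\<omega> :: 'd env) Z. if ?near Z then 1 else 0 :: real"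
  have reg: "regular ?F" "regular ?P" "regular ?G"
    by (rule regular_indicator, use P in measurable)+
  have tilt_bounds: "exp (s - e) \<le> tilt \<theta> (n + K) Z" "tilt \<theta> (n + K) Z \<le> exp (s + e)"
    if "\<And>i. Z i \<in> U" "?near Z" for Z
    using tilt_near_bounds[OF that(1) n that(2), where K = K and \<theta> = \<theta>] unfolding s_def e_def by auto
  have "exp (s - e) * annI (n + K) ?F = annI (n + K) (\<lambda>\<omega> Z. exp (s - e) * ?F \<omega> Z)"
    by (rule annI_cmult[symmetric])
  \<comment> \<open>The lower bound on the density holds on the conditioning event; off it the left
    integrand vanishes, so the event may be dropped on the right.\<close>
  also have "\<dots> \<le> tiltI \<theta> (n + K) ?P"
    unfolding tiltI_def
    using tilt_bounds(1)[OF stepseq_in_U]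
    by (intro annI_mono regular_mult regular_steps reg) (auto simp: less_imp_le[OF tilt_pos])
  finally have "exp (s - e) * annI (n + K) ?F \<le> b" using bad by linarith
  then have num: "annI (n + K) ?F \<le> b * exp (e - s)"
    by (simp add: exp_diff field_simps)
  have "tiltI \<theta> (n + K) ?G \<le> annI (n + K) (\<lambda>\<omega> Z. exp (s + e) * ?G \<omega> Z)"
    unfolding tiltI_def using tilt_bounds(2)[OF stepseq_in_U]
    by (intro annI_mono regular_mult regular_steps reg) auto
  also have "\<dots> = exp (s + e) * annI (n + K) ?G" by (rule annI_cmult)
  finally have "1 / 2 \<le> exp (s + e) * annI (n + K) ?G" using good by linarith
  then have den: "exp (- s - e) / 2 \<le> annI (n + K) ?G"
    by (simp add: exp_diff exp_add exp_minus field_simps)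
  have "0 \<le> annI (n + K) ?F"
    using annI_mono[OF regular_steps[of "\<lambda>_. 0"] reg(1), of "n + K"] by (simp add: annI_def)
  then have "annI (n + K) ?F / annI (n + K) ?G \<le> b * exp (e - s) / (exp (- s - e) / 2)"
    using num den by (intro frac_le) auto
  also have "\<dots> = 2 * b * exp (2 * e)"
    by (simp add: exp_diff exp_minus field_simps flip: exp_add)
  finally show ?thesis unfolding e_def by (simp add: mult.assoc)
qed

end

section \<open>From exponential bounds to the limits superior\<close>

lemma eln_mono: "x \<le> y \<Longrightarrow> eln x \<le> eln y"
  by (auto simp: eln_def)

text \<open>Dividing by \<open>n\<close> removes the contributions of \<open>C\<close> and
  \<open>a\<close>, and letting \<open>\<delta>\<close> tend to 0 removes that of \<open>b\<close>;
  the rate \<open>- c\<close> remains.\<close>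

lemma Limsup_rate_neg:
  fixes R :: "real \<Rightarrow> nat \<Rightarrow> real" and a b c C :: real
  assumes c: "0 < c" and C: "0 < C"
    and R: "\<And>\<delta>. 0 < \<delta> \<Longrightarrow> \<forall>\<^sub>F n in sequentially. R \<delta> n \<le> C * exp (a + b * \<delta> * real n - c * real n)"
  shows "Limsup (at_right 0) (\<lambda>\<delta>. limsup (\<lambda>n. ereal (1 / real n) * eln (R \<delta> n))) < 0"
proof -
  have lim: "limsup (\<lambda>n. ereal (1 / real n) * eln (R \<delta> n)) \<le> ereal (b * \<delta> - c)" if \<delta>: "0 < \<delta>" for \<delta>
  proof -
    have "\<forall>\<^sub>F n in sequentially. ereal (1 / real n) * eln (R \<delta> n)
        \<le> ereal ((ln C + a) / real n + (b * \<delta> - c))"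
      using R[OF \<delta>] eventually_gt_at_top[of 0]
    proof eventually_elim
      case (elim n)
      have "eln (R \<delta> n) \<le> eln (C * exp (a + b * \<delta> * real n - c * real n))"
        by (rule eln_mono) (rule elim(1))
      also have "\<dots> = ereal (ln C + (a + b * \<delta> * real n - c * real n))"
        using C by (simp add: eln_def ln_mult not_le)
      finally have "ereal (1 / real n) * eln (R \<delta> n)
          \<le> ereal (1 / real n) * ereal (ln C + (a + b * \<delta> * real n - c * real n))"
        by (intro ereal_mult_left_mono) auto
      also have "\<dots> = ereal ((ln C + a) / real n + (b * \<delta> - c))"
        using elim(2) by (simp add: field_simps)
      finally show ?case .
    qed
    then have "limsup (\<lambda>n. ereal (1 / real n) * eln (R \<delta> n))
        \<le> limsup (\<lambda>n. ereal ((ln C + a) / real n + (b * \<delta> - c)))"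
      by (rule Limsup_mono)
    also have "\<dots> = ereal (b * \<delta> - c)"
    proof (intro lim_imp_Limsup tendsto_ereal)
      have "(\<lambda>n. (ln C + a) / real n + (b * \<delta> - c)) \<longlonglongrightarrow> 0 + (b * \<delta> - c)"
        by (intro tendsto_intros lim_const_over_n)
      then show "(\<lambda>n. (ln C + a) / real n + (b * \<delta> - c)) \<longlonglongrightarrow> b * \<delta> - c" by simp
    qed simp
    finally show ?thesis .
  qed
  have "Limsup (at_right 0) (\<lambda>\<delta>. limsup (\<lambda>n. ereal (1 / real n) * eln (R \<delta> n)))
      \<le> Limsup (at_right 0) (\<lambda>\<delta>. ereal (b * \<delta> - c))"
    by (rule Limsup_mono, rule eventually_mono[OF eventually_at_right_less], rule lim)
  also have "\<dots> = ereal (- c)"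
  proof (intro lim_imp_Limsup tendsto_ereal)
    have "((\<lambda>\<delta>. b * \<delta> - c) \<longlongrightarrow> b * 0 - c) (at_right 0)"
      by (intro tendsto_intros)
    then show "((\<lambda>\<delta>. b * \<delta> - c) \<longlongrightarrow> - c) (at_right 0)" by simp
  qed simp
  also have "\<dots> < 0" using c by simp
  finally show ?thesis .
qed

theorem theorem1p18:
  fixes \<alpha> :: "(int^'d::finite \<Rightarrow> real) measure" and c1 :: real
    and \<xi> :: "real^'d" and N M K :: nat
    and f :: "'d env \<times> (nat \<Rightarrow> int^'d) \<Rightarrow> real" and \<epsilon> :: real
  assumes "prob_space \<alpha>" and "sets \<alpha> = sets locM"
    and "AE v in \<alpha>. v \<in> PV"
    and "c1 > 0" and "AE v in \<alpha>. \<forall>z\<in>U. c1 \<le> v z"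
    and "\<xi> \<in> interior {\<eta>. (\<Sum>i\<in>UNIV. \<bar>\<eta>$i\<bar>) \<le> 1}"
    and "\<exists>B. \<forall>\<omega>\<in>Omega. \<forall>s. (\<forall>i. s i \<in> U) \<longrightarrow> \<bar>f (\<omega>, s)\<bar> \<le> B"
    and "\<forall>\<omega>\<in>Omega. \<forall>s s'. (\<forall>i. s i \<in> U) \<longrightarrow> (\<forall>i. s' i \<in> U) \<longrightarrow>
            (\<forall>i<K. s i = s' i) \<longrightarrow> f (\<omega>, s) = f (\<omega>, s')"
    and "\<forall>s. (\<forall>i. s i \<in> U) \<longrightarrow>
            (\<lambda>\<omega>. f (\<omega>, s)) \<in> measurable (sigma Omega (Bplus (- int N) \<inter> Bminus (int M))) borel"
    and "\<epsilon> > 0"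
  shows "Limsup (at_right 0) (\<lambda>\<delta>::real. limsup (\<lambda>n.
           ereal (1 / real n) * eln
             (annP \<alpha> (n + K) (\<lambda>\<omega> Z. \<bar>nu_bar f n \<omega> Z - mu_bar \<alpha> \<xi> N M K f\<bar> > \<epsilon>
                                   \<and> norm (rvec (Xpos Z n) /\<^sub>R real n - \<xi>) \<le> \<delta>)
              / annP \<alpha> (n + K) (\<lambda>\<omega> Z. norm (rvec (Xpos Z n) /\<^sub>R real n - \<xi>) \<le> \<delta>))))
         < 0"
proof -
  interpret elliptic_rwre \<alpha> c1
    by (intro elliptic_rwre.intro rwre.intro rwre_axioms.intro elliptic_rwre_axioms.intro assms)
  define \<theta> where "\<theta> = theta_of \<alpha> \<xi>"
  define L where "L = N + M + K + 1"
  define V where "V = localize K f"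
  define \<mu> where "\<mu> = tiltI \<theta> L (moved N V)"
  have \<theta>: "(Lambda_c \<alpha> has_derivative (\<lambda>h. \<xi> \<bullet> h)) (at \<theta>)"
    unfolding \<theta>_def by (rule theta_of_has_derivative[OF interior_l1_ball[OF assms(6)]])
  obtain B where B: "\<And>\<omega> s. \<omega> \<in> Omega \<Longrightarrow> (\<And>i. s i \<in> U) \<Longrightarrow> \<bar>f (\<omega>, s)\<bar> \<le> B"
    using assms(7) by blast
  have VB: "\<bar>V \<omega> Z\<bar> \<le> B" for \<omega> Z
    unfolding V_def localize_def by (rule B) (auto simp: toOmega_in_Omega u0_in_U)
  have Vm: "(\<lambda>\<omega>. V \<omega> Z) \<in> borel_measurable (env_law \<alpha>)" for Z
    unfolding V_def localize_def
    by (rule measurable_toOmega_local, rule assms(9)[rule_format]) (auto simp: u0_in_U)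
  have regV: "regular V" using Vm VB unfolding regular_def by blast
  have V_moved: "moved j V \<omega> Z = f (shift (int j) (Xpos Z j) \<omega>, \<lambda>i. Z (j + i + 1))"
    if "\<omega> \<in> Omega" "\<And>i. Z i \<in> U" for j \<omega> Z
    unfolding moved_def V_def localize_def toOmega_id[OF shift_in_Omega[OF that(1)]]
    by (rule assms(8)[rule_format]) (auto simp: that shift_in_Omega u0_in_U)
  \<comment> \<open>After the translation the levels read are 0 to \<open>N + M\<close>, and the
    steps read are 1 to \<open>N\<close> for the position and \<open>N + 1\<close> to
    \<open>N + K\<close> for the step argument; all of this fits into \<open>L\<close>.\<close>
  have adV: "adapted L (moved N V)"
    unfolding adapted_def
  proof (intro allI impI)
    fix \<omega> \<omega>' :: "'d env" and Z Z' :: "nat \<Rightarrow> int^'d"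
    assume \<omega>: "\<forall>n\<in>{0..<int L}. \<forall>x. \<omega> (n, x) = \<omega>' (n, x)" and Z: "\<forall>i\<in>{1..L}. Z i = Z' i"
    have X: "Xpos Z N = Xpos Z' N" by (rule Xpos_cong) (use Z in \<open>auto simp: L_def\<close>)
    let ?s = "\<lambda>Z i. if i < K \<and> Z (N + (i + 1)) \<in> U then Z (N + (i + 1)) else u0"
    have s: "?s Z = ?s Z'"
    proof
      fix i show "?s Z i = ?s Z' i"
        using Z by (cases "i < K") (auto simp: L_def)
    qed
    have "f (toOmega (shift (int N) (Xpos Z' N) \<omega>), ?s Z') = f (toOmega (shift (int N) (Xpos Z' N) \<omega>'), ?s Z')"
    proof (rule local_cong[where g = "\<lambda>\<omega>. f (\<omega>, ?s Z')"])
      show "(\<lambda>\<omega>. f (\<omega>, ?s Z')) \<in> borel_measurable (sigma Omega (Bplus (- int N) \<inter> Bminus (int M)))"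
        by (rule assms(9)[rule_format]) (auto simp: u0_in_U)
    qed (simp_all add: toOmega_in_Omega, use \<omega> in \<open>simp add: toOmega_def shift_def L_def\<close>)
    then show "moved N V \<omega> Z = moved N V \<omega>' Z'"
      unfolding moved_def V_def localize_def X s .
  qed
  have nu: "nu_bar f n \<omega> (stepseq zs) = 1 / real n * (\<Sum>j<n. moved j V \<omega> (stepseq zs))"
    if "\<omega> \<in> Omega" "zs \<in> paths m" for n m \<omega> and zs :: "(int^'d) list"
    unfolding nu_bar_def using V_moved[OF that(1) stepseq_in_U[OF that(2)]] by simp
  \<comment> \<open>The definition of \<open>mu_bar\<close> starts at time \<open>N\<close> and has
    horizon \<open>L\<close>, so it is precisely the tilted expectation of the translated
    observable.\<close>
  have mu: "mu_bar \<alpha> \<xi> N M K f = \<mu>"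
    unfolding mu_bar_def Let_def \<mu>_def tiltI_def L_def[symmetric] \<theta>_def[symmetric]
    by (rule annE_eq_annI)
      (auto intro!: regular_mult regular_steps regular_moved regV simp: tilt_def V_moved stepseq_in_U)
  let ?near = "\<lambda>\<delta> n Z. norm (rvec (Xpos Z n) /\<^sub>R real n - \<xi>) \<le> \<delta>"
  let ?dev = "\<lambda>n \<omega> Z. \<epsilon> < \<bar>1 / real n * (\<Sum>j<n. moved j V \<omega> Z) - \<mu>\<bar>"
  have dev_m: "Measurable.pred (env_law \<alpha>) (\<lambda>\<omega>. ?dev n \<omega> Z)" for n Z
  proof -
    have [measurable]: "(\<lambda>\<omega>. moved j V \<omega> Z) \<in> borel_measurable (env_law \<alpha>)" for j
      by (intro regularD(1) regular_moved regV)
    show ?thesis by measurable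
  qed
  have num: "annP \<alpha> m (\<lambda>\<omega> Z. \<bar>nu_bar f n \<omega> Z - mu_bar \<alpha> \<xi> N M K f\<bar> > \<epsilon> \<and> ?near \<delta> n Z)
      = annI m (\<lambda>\<omega> Z. if ?dev n \<omega> Z \<and> ?near \<delta> n Z then 1 else 0)" for m n \<delta>
    unfolding annP_def mu
    by (rule annE_eq_annI) (rule regular_indicator, use dev_m in measurable, simp add: nu)
  have den: "annP \<alpha> m (\<lambda>\<omega> Z. ?near \<delta> n Z) = annI m (\<lambda>\<omega> Z. if ?near \<delta> n Z then 1 else 0)" for m n \<delta>
    unfolding annP_def by (rule annE_eq_annI) (rule regular_steps, simp)
  have "0 < L" by (simp add: L_def)
  obtain c where c: "0 < c" and conc: "\<forall>\<^sub>F n in sequentially. \<forall>m\<ge>n.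
      tiltI \<theta> m (\<lambda>\<omega> Z. if ?dev n \<omega> Z then 1 else 0) \<le> 2 * real L * exp (- c * real n)"
    using tiltI_local_average[OF regV VB adV \<open>0 < L\<close> assms(10), of \<theta>] unfolding \<mu>_def by blast
  show ?thesis
  \<comment> \<open>\<open>C\<close> doubles the prefactor of the concentration bound;
    \<open>a\<close> and \<open>b\<close> separate the \<open>K\<close> part of the density error
    from its \<open>\<delta>\<close> part, each counted twice.\<close>
  proof (rule Limsup_rate_neg[where c = c and C = "4 * real L" and a = "2 * norm \<theta> * real K" and b = "2 * norm \<theta>"])
    fix \<delta> :: real assume \<delta>: "0 < \<delta>"
    show "\<forall>\<^sub>F n in sequentially.
        annP \<alpha> (n + K) (\<lambda>\<omega> Z. \<bar>nu_bar f n \<omega> Z - mu_bar \<alpha> \<xi> N M K f\<bar> > \<epsilon> \<and> ?near \<delta> n Z)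
          / annP \<alpha> (n + K) (\<lambda>\<omega> Z. ?near \<delta> n Z)
        \<le> 4 * real L * exp (2 * norm \<theta> * real K + 2 * norm \<theta> * \<delta> * real n - c * real n)"
      using conc tiltI_near_mean[OF \<theta> \<delta>] eventually_gt_at_top[of 0]
    proof eventually_elim
      case (elim n)
      have "annI (n + K) (\<lambda>\<omega> Z. if ?dev n \<omega> Z \<and> ?near \<delta> n Z then 1 else 0)
          / annI (n + K) (\<lambda>\<omega> Z. if ?near \<delta> n Z then 1 else 0)
        \<le> 2 * (2 * real L * exp (- c * real n)) * exp (2 * norm \<theta> * (real K + real n * \<delta>))"
        using elim by (intro annI_ratio_le dev_m) auto
      also have "\<dots> = 4 * real L * exp (2 * norm \<theta> * real K + 2 * norm \<theta> * \<delta> * real n - c * real n)"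
        by (simp add: algebra_simps flip: exp_add)
      finally show ?case unfolding num den .
    qed
  qed (use c \<open>0 < L\<close> in auto)
qed

end
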